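(* Let $(A,\circ)$ be a finite-dimensional Novikov algebra over $\mathbf{k}$ with a nondegenerate bilinear form $\omega(\cdot,\cdot)$. Let $\{e_\alpha\mid\alpha\in I\}$ be a basis of $A$ and $\{f_\alpha\mid\alpha\in I\}$ its dual basis associated with $\omega(\cdot,\cdot)$. Set $r=\sum_{\alpha\in I}e_\alpha\otimes f_\alpha\in A\otimes A$ and let $L=A[t,t^{-1}]=A\otimes\mathbf{k}[t,t^{-1}]$ be the affinization of $(A,\circ)$. Then the following conditions are equivalent. (a) $(A,\circ,\omega(\cdot,\cdot))$ is a quasi-Frobenius Novikov algebra. (b) $r$ is a skewsymmetric solution of the Novikov Yang-Baxter equation in $A$. (c) $r_L=\sum_{i\in\mathbb{Z}}\sum_{\alpha\in I}e_\alpha t^i\otimes f_\alpha t^{-i-1}\in L\,\widehat{\otimes}\,L$ is a skewsymmetric completed solution of the classical Yang-Baxter equation in $L$. (d) $(L,(\cdot,\cdot)_L)$ is a quasi-Frobenius $\mathbb{Z}$-graded Lie algebra with $(\cdot,\cdot)_L$ defined by $(at^i,bt^j)_L=\omega(a,b)\delta_{i+j+1,0}$ for all $a,b\in A$ and $i,j\in\mathbb{Z}$.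
   Context: $\mathbf{k}$ is a field of characteristic zero. A Novikov algebra $(A,\circ)$: $(a\circ b)\circ c-a\circ(b\circ c)=(b\circ a)\circ c-b\circ(a\circ c)$ and $(a\circ b)\circ c=(a\circ c)\circ b$; $a\star b:=a\circ b+b\circ a$. Dual basis: $\omega(e_\alpha,f_\beta)=\delta_{\alpha,\beta}$. A quasi-Frobenius Novikov algebra $(A,\circ,\omega)$ is a Novikov algebra with a skewsymmetric nondegenerate bilinear form $\omega$ such that $\omega(a\circ b,c)-\omega(a\star c,b)+\omega(c\circ b,a)=0$ for all $a,b,c\in A$. Novikov Yang-Baxter equation for $r=\sum x_\alpha\otimes y_\alpha\in A\otimes A$: $\sum_{\alpha,\beta}\big(x_\alpha\otimes x_\beta\otimes y_\alpha\circ y_\beta+x_\alpha\otimes(y_\alpha\star x_\beta)\otimes y_\beta+x_\alpha\circ x_\beta\otimes y_\beta\otimes y_\alpha\big)=0$; skewsymmetric: $\tau r=-r$ with $\tau$ the flip. The affinization $L$ has Lie bracket $[at^i,bt^j]=i(a\circ b)t^{i+j-1}-j(b\circ a)t^{i+j-1}$, where $at^i=a\otimes t^i$, and is $\mathbb{Z}$-graded by $L_i=A\otimes\mathbf{k}t^{i+1}$. $L\,\widehat{\otimes}\,L:=\prod_{i,j}L_i\otimes L_j$ and $L\,\widehat{\otimes}\,L\,\widehat{\otimes}\,L:=\prod_{i,j,k}L_i\otimes L_j\otimes L_k$; elements are written as formal sums of homogeneous tensors. An element $s=\sum_ia_i\otimes b_i\in L\,\widehat{\otimes}\,L$ is skewsymmetric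 if its termwise flip $\sum_ib_i\otimes a_i$ equals $-s$; a skewsymmetric $s$ is a completed solution of the classical Yang-Baxter equation in $L$ if $\sum_{i,j}\big([a_i,a_j]\otimes b_i\otimes b_j+a_i\otimes[b_i,a_j]\otimes b_j+a_i\otimes a_j\otimes[b_i,b_j]\big)=0$ in $L\,\widehat{\otimes}\,L\,\widehat{\otimes}\,L$ (for $r_L$, only finitely many terms contribute in each multidegree). A quasi-Frobenius $\mathbb{Z}$-graded Lie algebra is a $\mathbb{Z}$-graded Lie algebra $L=\oplus L_i$ (each $L_i$ finite-dimensional, $[L_i,L_j]\subset L_{i+j}$) with a skewsymmetric nondegenerate bilinear form $(\cdot,\cdot)_L$ that is graded (there is $m\in\mathbb{Z}$ with $(L_i,L_j)_L=0$ whenever $i+j+m\neq0$) and satisfies $([a,b],c)_L+([c,a],b)_L+([b,c],a)_L=0$ for all $a,b,c\in L$. *)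

theory Defs
  imports Complex_Main "HOL-Library.Poly_Mapping"
begin

definition bilinear_map ::
  "('k::field \<Rightarrow> 'u::ab_group_add \<Rightarrow> 'u) \<Rightarrow> ('k \<Rightarrow> 'v::ab_group_add \<Rightarrow> 'v)
    \<Rightarrow> ('k \<Rightarrow> 'w::ab_group_add \<Rightarrow> 'w) \<Rightarrow> ('u \<Rightarrow> 'v \<Rightarrow> 'w) \<Rightarrow> bool" where
  "bilinear_map s1 s2 s3 h \<longleftrightarrow>
     (\<forall>x. Vector_Spaces.linear s2 s3 (h x)) \<and>
     (\<forall>y. Vector_Spaces.linear s1 s3 (\<lambda>x. h x y))"

definition bilinear_form ::
  "('k::field \<Rightarrow> 'v::ab_group_add \<Rightarrow> 'v) \<Rightarrow> ('v \<Rightarrow> 'v \<Rightarrow> 'k) \<Rightarrow> bool" where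
  "bilinear_form s \<omega> \<longleftrightarrow> bilinear_map s s (*) \<omega>"

definition nondegenerate_form :: "('v::ab_group_add \<Rightarrow> 'v \<Rightarrow> 'k::field) \<Rightarrow> bool" where
  "nondegenerate_form \<omega> \<longleftrightarrow>
     (\<forall>a. (\<forall>b. \<omega> a b = 0) \<longrightarrow> a = 0) \<and>
     (\<forall>b. (\<forall>a. \<omega> a b = 0) \<longrightarrow> b = 0)"

definition skewsymmetric_form :: "('v \<Rightarrow> 'v \<Rightarrow> 'k::field) \<Rightarrow> bool" where
  "skewsymmetric_form \<omega> \<longleftrightarrow> (\<forall>a b. \<omega> a b = - \<omega> b a)"

definition novikov_algebra ::
  "('k::field \<Rightarrow> 'a::ab_group_add \<Rightarrow> 'a) \<Rightarrow> ('a \<Rightarrow> 'a \<Rightarrow> 'a) \<Rightarrow> bool" where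
  "novikov_algebra s m \<longleftrightarrow>
     vector_space s \<and> bilinear_map s s s m \<and>
     (\<forall>a b c. m (m a b) c - m a (m b c) = m (m b a) c - m b (m a c)) \<and>
     (\<forall>a b c. m (m a b) c = m (m a c) b)"

definition star_product :: "('a::ab_group_add \<Rightarrow> 'a \<Rightarrow> 'a) \<Rightarrow> 'a \<Rightarrow> 'a \<Rightarrow> 'a" where
  "star_product m a b = m a b + m b a"

definition quasi_Frobenius_novikov ::
  "('k::field \<Rightarrow> 'a::ab_group_add \<Rightarrow> 'a) \<Rightarrow> ('a \<Rightarrow> 'a \<Rightarrow> 'a) \<Rightarrow> ('a \<Rightarrow> 'a \<Rightarrow> 'k) \<Rightarrow> bool" where
  "quasi_Frobenius_novikov s m \<omega> \<longleftrightarrow>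
     novikov_algebra s m \<and>
     bilinear_form s \<omega> \<and> skewsymmetric_form \<omega> \<and> nondegenerate_form \<omega> \<and>
     (\<forall>a b c. \<omega> (m a b) c - \<omega> (star_product m a c) b + \<omega> (m c b) a = 0)"

text \<open>
  The tensor product of subspaces \<open>V\<close>, \<open>W\<close> of a vector space is the quotient of the free vector
  space on \<open>V \<times> W\<close> by the span of the bilinearity relations, and likewise for three factors.
  A tensor is represented by a formal linear combination of pairs (triples); it vanishes in the
  tensor product iff the representative lies in the span of the relations.
\<close>

definition free_scale :: "'k::field \<Rightarrow> ('x \<Rightarrow>\<^sub>0 'k) \<Rightarrow> ('x \<Rightarrow>\<^sub>0 'k)" where
  "free_scale c u = Poly_Mapping.map ((*) c) u"

definition pure2 :: "'v \<Rightarrow> 'v \<Rightarrow> (('v \<times> 'v) \<Rightarrow>\<^sub>0 'k::field)" where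
  "pure2 x y = Poly_Mapping.single (x, y) 1"

definition pure3 :: "'v \<Rightarrow> 'v \<Rightarrow> 'v \<Rightarrow> (('v \<times> 'v \<times> 'v) \<Rightarrow>\<^sub>0 'k::field)" where
  "pure3 x y z = Poly_Mapping.single (x, y, z) 1"

definition tensor2_relations ::
  "('k::field \<Rightarrow> 'v::ab_group_add \<Rightarrow> 'v) \<Rightarrow> 'v set \<Rightarrow> 'v set \<Rightarrow> (('v \<times> 'v) \<Rightarrow>\<^sub>0 'k) set" where
  "tensor2_relations s V W =
     {pure2 (x + x') y - pure2 x y - pure2 x' y | x x' y. x \<in> V \<and> x' \<in> V \<and> y \<in> W} \<union>
     {pure2 x (y + y') - pure2 x y - pure2 x y' | x y y'. x \<in> V \<and> y \<in> W \<and> y' \<in> W} \<union>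
     {pure2 (s c x) y - free_scale c (pure2 x y) | c x y. x \<in> V \<and> y \<in> W} \<union>
     {pure2 x (s c y) - free_scale c (pure2 x y) | c x y. x \<in> V \<and> y \<in> W}"

definition tensor3_relations ::
  "('k::field \<Rightarrow> 'v::ab_group_add \<Rightarrow> 'v) \<Rightarrow> 'v set \<Rightarrow> 'v set \<Rightarrow> 'v set
    \<Rightarrow> (('v \<times> 'v \<times> 'v) \<Rightarrow>\<^sub>0 'k) set" where
  "tensor3_relations s U V W =
     {pure3 (x + x') y z - pure3 x y z - pure3 x' y z | x x' y z.
        x \<in> U \<and> x' \<in> U \<and> y \<in> V \<and> z \<in> W} \<union>
     {pure3 x (y + y') z - pure3 x y z - pure3 x y' z | x y y' z.
        x \<in> U \<and> y \<in> V \<and> y' \<in> V \<and> z \<in> W} \<union>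
     {pure3 x y (z + z') - pure3 x y z - pure3 x y z' | x y z z'.
        x \<in> U \<and> y \<in> V \<and> z \<in> W \<and> z' \<in> W} \<union>
     {pure3 (s c x) y z - free_scale c (pure3 x y z) | c x y z. x \<in> U \<and> y \<in> V \<and> z \<in> W} \<union>
     {pure3 x (s c y) z - free_scale c (pure3 x y z) | c x y z. x \<in> U \<and> y \<in> V \<and> z \<in> W} \<union>
     {pure3 x y (s c z) - free_scale c (pure3 x y z) | c x y z. x \<in> U \<and> y \<in> V \<and> z \<in> W}"

definition tensor2_eq ::
  "('k::field \<Rightarrow> 'v::ab_group_add \<Rightarrow> 'v) \<Rightarrow> 'v set \<Rightarrow> 'v set
    \<Rightarrow> (('v \<times> 'v) \<Rightarrow>\<^sub>0 'k) \<Rightarrow> (('v \<times> 'v) \<Rightarrow>\<^sub>0 'k) \<Rightarrow> bool" where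
  "tensor2_eq s V W u v \<longleftrightarrow> u - v \<in> module.span free_scale (tensor2_relations s V W)"

definition tensor3_eq ::
  "('k::field \<Rightarrow> 'v::ab_group_add \<Rightarrow> 'v) \<Rightarrow> 'v set \<Rightarrow> 'v set \<Rightarrow> 'v set
    \<Rightarrow> (('v \<times> 'v \<times> 'v) \<Rightarrow>\<^sub>0 'k) \<Rightarrow> (('v \<times> 'v \<times> 'v) \<Rightarrow>\<^sub>0 'k) \<Rightarrow> bool" where
  "tensor3_eq s U V W u v \<longleftrightarrow> u - v \<in> module.span free_scale (tensor3_relations s U V W)"

text \<open>The tensor \<open>r = \<Sum>p\<in>P. x p \<otimes> y p\<close> is given by the finite family \<open>P, x, y\<close>;
  both conditions below depend only on the tensor, not on the chosen presentation.\<close>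

definition skewsymmetric_tensor ::
  "('k::field \<Rightarrow> 'a::ab_group_add \<Rightarrow> 'a) \<Rightarrow> 'p set \<Rightarrow> ('p \<Rightarrow> 'a) \<Rightarrow> ('p \<Rightarrow> 'a) \<Rightarrow> bool" where
  "skewsymmetric_tensor s P x y \<longleftrightarrow>
     tensor2_eq s UNIV UNIV (\<Sum>p\<in>P. pure2 (y p) (x p)) (- (\<Sum>p\<in>P. pure2 (x p) (y p)))"

definition novikov_YBE ::
  "('k::field \<Rightarrow> 'a::ab_group_add \<Rightarrow> 'a) \<Rightarrow> ('a \<Rightarrow> 'a \<Rightarrow> 'a)
    \<Rightarrow> 'p set \<Rightarrow> ('p \<Rightarrow> 'a) \<Rightarrow> ('p \<Rightarrow> 'a) \<Rightarrow> bool" where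
  "novikov_YBE s m P x y \<longleftrightarrow>
     tensor3_eq s UNIV UNIV UNIV
       (\<Sum>p\<in>P. \<Sum>q\<in>P. pure3 (x p) (x q) (m (y p) (y q))
          + pure3 (x p) (star_product m (y p) (x q)) (y q)
          + pure3 (m (x p) (x q)) (y q) (y p))
       0"

definition lie_algebra ::
  "('k::field \<Rightarrow> 'l::ab_group_add \<Rightarrow> 'l) \<Rightarrow> ('l \<Rightarrow> 'l \<Rightarrow> 'l) \<Rightarrow> bool" where
  "lie_algebra s br \<longleftrightarrow>
     vector_space s \<and> bilinear_map s s s br \<and>
     (\<forall>x. br x x = 0) \<and>
     (\<forall>x y z. br x (br y z) + br y (br z x) + br z (br x y) = 0)"

definition Z_grading ::
  "('k::field \<Rightarrow> 'l::ab_group_add \<Rightarrow> 'l) \<Rightarrow> (int \<Rightarrow> 'l set) \<Rightarrow> bool" where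
  "Z_grading s L \<longleftrightarrow>
     (\<forall>i. module.subspace s (L i)) \<and>
     (\<forall>x. \<exists>!d. (\<forall>i. d i \<in> L i) \<and> finite {i. d i \<noteq> 0} \<and> x = (\<Sum>i\<in>{i. d i \<noteq> 0}. d i))"

definition graded_lie_algebra ::
  "('k::field \<Rightarrow> 'l::ab_group_add \<Rightarrow> 'l) \<Rightarrow> ('l \<Rightarrow> 'l \<Rightarrow> 'l) \<Rightarrow> (int \<Rightarrow> 'l set) \<Rightarrow> bool" where
  "graded_lie_algebra s br L \<longleftrightarrow>
     lie_algebra s br \<and> Z_grading s L \<and>
     (\<forall>i. \<exists>B. finite B \<and> module.span s B = L i) \<and>
     (\<forall>i j. \<forall>x\<in>L i. \<forall>y\<in>L j. br x y \<in> L (i + j))"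

definition quasi_Frobenius_graded_lie_algebra ::
  "('k::field \<Rightarrow> 'l::ab_group_add \<Rightarrow> 'l) \<Rightarrow> ('l \<Rightarrow> 'l \<Rightarrow> 'l) \<Rightarrow> (int \<Rightarrow> 'l set)
    \<Rightarrow> ('l \<Rightarrow> 'l \<Rightarrow> 'k) \<Rightarrow> bool" where
  "quasi_Frobenius_graded_lie_algebra s br L B \<longleftrightarrow>
     graded_lie_algebra s br L \<and>
     bilinear_form s B \<and> skewsymmetric_form B \<and> nondegenerate_form B \<and>
     (\<exists>m. \<forall>i j. i + j + m \<noteq> 0 \<longrightarrow> (\<forall>x\<in>L i. \<forall>y\<in>L j. B x y = 0)) \<and>
     (\<forall>a b c. B (br a b) c + B (br c a) b + B (br b c) a = 0)"

text \<open>
  An element of the completed tensor product, \<open>\<Prod>i j. L i \<otimes> L j\<close>, is given by a possibly infinite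
  family \<open>P, a, b\<close>, standing for the formal sum of the homogeneous tensors \<open>a p \<otimes> b p\<close>.  Its component
  in bidegree \<open>(i, j)\<close> is the sum of the terms lying there.  Nonzero homogeneous elements have a
  unique degree; terms with a zero factor lie in every multidegree but contribute nothing and are
  left out.  Since sums over infinite sets are \<open>0\<close> by convention, finiteness in each multidegree
  has to be required explicitly.
\<close>

definition homogeneous :: "(int \<Rightarrow> 'l set) \<Rightarrow> 'l \<Rightarrow> bool" where
  "homogeneous L x \<longleftrightarrow> (\<exists>i. x \<in> L i)"

definition terms2 ::
  "(int \<Rightarrow> 'l::zero set) \<Rightarrow> 'p set \<Rightarrow> ('p \<Rightarrow> 'l) \<Rightarrow> ('p \<Rightarrow> 'l) \<Rightarrow> int \<Rightarrow> int \<Rightarrow> 'p set" where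
  "terms2 L P a b i j = {p \<in> P. a p \<in> L i - {0} \<and> b p \<in> L j - {0}}"

definition formal_sum2 ::
  "(int \<Rightarrow> 'l::zero set) \<Rightarrow> 'p set \<Rightarrow> ('p \<Rightarrow> 'l) \<Rightarrow> ('p \<Rightarrow> 'l) \<Rightarrow> bool" where
  "formal_sum2 L P a b \<longleftrightarrow>
     (\<forall>p\<in>P. homogeneous L (a p) \<and> homogeneous L (b p)) \<and>
     (\<forall>i j. finite (terms2 L P a b i j))"

definition component2 ::
  "(int \<Rightarrow> 'l::zero set) \<Rightarrow> 'p set \<Rightarrow> ('p \<Rightarrow> 'l) \<Rightarrow> ('p \<Rightarrow> 'l)
    \<Rightarrow> int \<Rightarrow> int \<Rightarrow> (('l \<times> 'l) \<Rightarrow>\<^sub>0 'k::field)" where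
  "component2 L P a b i j = (\<Sum>p\<in>terms2 L P a b i j. pure2 (a p) (b p))"

definition terms3 ::
  "(int \<Rightarrow> 'l::zero set) \<Rightarrow> 'p set \<Rightarrow> ('p \<Rightarrow> 'l) \<Rightarrow> ('p \<Rightarrow> 'l) \<Rightarrow> ('p \<Rightarrow> 'l)
    \<Rightarrow> int \<Rightarrow> int \<Rightarrow> int \<Rightarrow> 'p set" where
  "terms3 L P a b c i j k = {p \<in> P. a p \<in> L i - {0} \<and> b p \<in> L j - {0} \<and> c p \<in> L k - {0}}"

definition formal_sum3 ::
  "(int \<Rightarrow> 'l::zero set) \<Rightarrow> 'p set \<Rightarrow> ('p \<Rightarrow> 'l) \<Rightarrow> ('p \<Rightarrow> 'l) \<Rightarrow> ('p \<Rightarrow> 'l) \<Rightarrow> bool" where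
  "formal_sum3 L P a b c \<longleftrightarrow>
     (\<forall>p\<in>P. homogeneous L (a p) \<and> homogeneous L (b p) \<and> homogeneous L (c p)) \<and>
     (\<forall>i j k. finite (terms3 L P a b c i j k))"

definition component3 ::
  "(int \<Rightarrow> 'l::zero set) \<Rightarrow> 'p set \<Rightarrow> ('p \<Rightarrow> 'l) \<Rightarrow> ('p \<Rightarrow> 'l) \<Rightarrow> ('p \<Rightarrow> 'l)
    \<Rightarrow> int \<Rightarrow> int \<Rightarrow> int \<Rightarrow> (('l \<times> 'l \<times> 'l) \<Rightarrow>\<^sub>0 'k::field)" where
  "component3 L P a b c i j k = (\<Sum>p\<in>terms3 L P a b c i j k. pure3 (a p) (b p) (c p))"

definition skewsymmetric_completed ::
  "('k::field \<Rightarrow> 'l::ab_group_add \<Rightarrow> 'l) \<Rightarrow> (int \<Rightarrow> 'l set)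
    \<Rightarrow> 'p set \<Rightarrow> ('p \<Rightarrow> 'l) \<Rightarrow> ('p \<Rightarrow> 'l) \<Rightarrow> bool" where
  "skewsymmetric_completed s L P a b \<longleftrightarrow>
     formal_sum2 L P a b \<and>
     (\<forall>i j. tensor2_eq s (L i) (L j) (component2 L P b a i j) (- component2 L P a b i j))"

definition completed_CYBE ::
  "('k::field \<Rightarrow> 'l::ab_group_add \<Rightarrow> 'l) \<Rightarrow> ('l \<Rightarrow> 'l \<Rightarrow> 'l) \<Rightarrow> (int \<Rightarrow> 'l set)
    \<Rightarrow> 'p set \<Rightarrow> ('p \<Rightarrow> 'l) \<Rightarrow> ('p \<Rightarrow> 'l) \<Rightarrow> bool" where
  "completed_CYBE s br L P a b \<longleftrightarrow>
     formal_sum3 L (P \<times> P) (\<lambda>(p, q). br (a p) (a q)) (\<lambda>(p, q). b p) (\<lambda>(p, q). b q) \<and>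
     formal_sum3 L (P \<times> P) (\<lambda>(p, q). a p) (\<lambda>(p, q). br (b p) (a q)) (\<lambda>(p, q). b q) \<and>
     formal_sum3 L (P \<times> P) (\<lambda>(p, q). a p) (\<lambda>(p, q). a q) (\<lambda>(p, q). br (b p) (b q)) \<and>
     (\<forall>i j k. tensor3_eq s (L i) (L j) (L k)
        (component3 L (P \<times> P) (\<lambda>(p, q). br (a p) (a q)) (\<lambda>(p, q). b p) (\<lambda>(p, q). b q) i j k
         + component3 L (P \<times> P) (\<lambda>(p, q). a p) (\<lambda>(p, q). br (b p) (a q)) (\<lambda>(p, q). b q) i j k
         + component3 L (P \<times> P) (\<lambda>(p, q). a p) (\<lambda>(p, q). a q) (\<lambda>(p, q). br (b p) (b q)) i j k)
        0)"

definition skewsymmetric_completed_CYBE_solution ::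
  "('k::field \<Rightarrow> 'l::ab_group_add \<Rightarrow> 'l) \<Rightarrow> ('l \<Rightarrow> 'l \<Rightarrow> 'l) \<Rightarrow> (int \<Rightarrow> 'l set)
    \<Rightarrow> 'p set \<Rightarrow> ('p \<Rightarrow> 'l) \<Rightarrow> ('p \<Rightarrow> 'l) \<Rightarrow> bool" where
  "skewsymmetric_completed_CYBE_solution s br L P a b \<longleftrightarrow>
     skewsymmetric_completed s L P a b \<and> completed_CYBE s br L P a b"

text \<open>
  \<open>A[t, t\<^sup>-\<^sup>1]\<close> is the type \<open>int \<Rightarrow>\<^sub>0 'a\<close> of Laurent polynomials with coefficients in \<open>A\<close>.
  The bracket and the form are the bilinear extensions of the formulas on the elements \<open>a t\<^sup>i\<close>,
  see \<open>aff_bracket_monom\<close> and \<open>aff_form_monom\<close>.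
\<close>

definition aff_monom :: "'a::zero \<Rightarrow> int \<Rightarrow> (int \<Rightarrow>\<^sub>0 'a)" where
  "aff_monom a i = Poly_Mapping.single i a"

definition aff_scale ::
  "('k::field \<Rightarrow> 'a::ab_group_add \<Rightarrow> 'a) \<Rightarrow> 'k \<Rightarrow> (int \<Rightarrow>\<^sub>0 'a) \<Rightarrow> (int \<Rightarrow>\<^sub>0 'a)" where
  "aff_scale s c x = Poly_Mapping.map (s c) x"

definition aff_bracket ::
  "('k::field \<Rightarrow> 'a::ab_group_add \<Rightarrow> 'a) \<Rightarrow> ('a \<Rightarrow> 'a \<Rightarrow> 'a)
    \<Rightarrow> (int \<Rightarrow>\<^sub>0 'a) \<Rightarrow> (int \<Rightarrow>\<^sub>0 'a) \<Rightarrow> (int \<Rightarrow>\<^sub>0 'a)" where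
  "aff_bracket s m x y =
     (\<Sum>i\<in>Poly_Mapping.keys x. \<Sum>j\<in>Poly_Mapping.keys y.
        aff_monom (s (of_int i) (m (Poly_Mapping.lookup x i) (Poly_Mapping.lookup y j))) (i + j - 1)
        - aff_monom (s (of_int j) (m (Poly_Mapping.lookup y j) (Poly_Mapping.lookup x i))) (i + j - 1))"

definition aff_degree :: "int \<Rightarrow> (int \<Rightarrow>\<^sub>0 'a::zero) set" where
  "aff_degree i = {aff_monom a (i + 1) | a. True}"

definition aff_form ::
  "('a::ab_group_add \<Rightarrow> 'a \<Rightarrow> 'k::field) \<Rightarrow> (int \<Rightarrow>\<^sub>0 'a) \<Rightarrow> (int \<Rightarrow>\<^sub>0 'a) \<Rightarrow> 'k" where
  "aff_form \<omega> x y =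
     (\<Sum>i\<in>Poly_Mapping.keys x. \<Sum>j\<in>Poly_Mapping.keys y.
        \<omega> (Poly_Mapping.lookup x i) (Poly_Mapping.lookup y j) * (if i + j + 1 = 0 then 1 else 0))"

lemma bilinear_map_zero:
  assumes "bilinear_map s1 s2 s3 h"
  shows "h 0 y = 0" and "h x 0 = 0"
proof -
  have "module_hom s1 s3 (\<lambda>x. h x y)" "module_hom s2 s3 (h x)"
    using assms by (auto simp: bilinear_map_def module_hom_eq_linear)
  then show "h 0 y = 0" "h x 0 = 0"
    using module_hom.zero by fastforce+
qed

lemma aff_bracket_monom:
  assumes "novikov_algebra s m"
  shows "aff_bracket s m (aff_monom a i) (aff_monom b j) =
    aff_monom (s (of_int i) (m a b)) (i + j - 1) - aff_monom (s (of_int j) (m b a)) (i + j - 1)"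
proof -
  have bil: "bilinear_map s s s m" and vs: "vector_space s"
    using assms by (auto simp: novikov_algebra_def)
  interpret vector_space s by (fact vs)
  show ?thesis
    by (simp add: aff_bracket_def aff_monom_def bilinear_map_zero[OF bil])
qed

lemma aff_form_monom:
  assumes "bilinear_form s \<omega>"
  shows "aff_form \<omega> (aff_monom a i) (aff_monom b j) = \<omega> a b * (if i + j + 1 = 0 then 1 else 0)"
  using bilinear_map_zero[of s s "(*)" \<omega>] assms
  by (simp add: aff_form_def aff_monom_def bilinear_form_def)

end

theory Submission
  imports Defs
begin

text \<open>
  Each of the four conditions turns out to say the same two things about \<open>\<omega>\<close>: it is
  skewsymmetric, and it satisfies the cocycle identity
  \<open>\<omega> (a \<circ> b) c - \<omega> (a \<star> c) b + \<omega> (c \<circ> b) a = 0\<close>.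

  For the two tensor conditions, the point is that a tensor over a space with dual bases
  vanishes iff all its pairings with vectors through the form vanish (\<open>tensor2_eq_iff_pairing\<close>,
  \<open>tensor3_eq_iff_pairing\<close>). The element \<open>r = \<Sum> e\<^sub>\<alpha> \<otimes> f\<^sub>\<alpha>\<close> represents the identity map: summing
  \<open>\<omega> e\<^sub>\<alpha> a\<close> times \<open>f\<^sub>\<alpha>\<close> returns \<open>a\<close>, and if \<open>\<omega>\<close> is skewsymmetric, summing \<open>\<omega> f\<^sub>\<alpha> a\<close> times \<open>e\<^sub>\<alpha>\<close>
  returns \<open>- a\<close>. Hence the pairing of \<open>r\<close> plus its flip with \<open>a, b\<close> is \<open>\<omega> b a + \<omega> a b\<close>. In each
  term of a Yang-Baxter equation two legs are paired off and one product is left, so contraction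
  (\<open>product_contraction\<close>) replaces the legs by the vectors that they are paired with. The three
  terms of the Novikov equation become the three terms of the cocycle identity.

  The same computation works in the affinization, where the form \<open>(a t\<^sup>i, b t\<^sup>j) = \<omega> a b \<delta>\<close>
  pairs each degree perfectly with one other degree, so that every multidegree of the completed
  tensor product can be tested separately. It turns the classical Yang-Baxter equation for \<open>r\<^sub>L\<close>
  into the cyclic identity of a quasi-Frobenius Lie algebra, tested on monomials
  (\<open>completed_CYBE_iff\<close>).

  What remains is to compare the cyclic identity on \<open>a t\<^sup>i, b t\<^sup>j, c t\<^sup>k\<close> with the cocycle
  identity. The cyclic sum vanishes unless \<open>i + j + k = 0\<close>. Eliminating \<open>k\<close> leaves an expression linear in
  \<open>i\<close> and \<open>j\<close>, whose coefficients are the cocycle expressions for \<open>(a, b, c)\<close> and, up to sign,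
  \<open>(b, a, c)\<close> (\<open>L_cyclic_sum_monom\<close>). The affinization itself is a graded Lie algebra because
  \<open>A\<close> is a Novikov algebra (\<open>lie_algebra_affinization\<close>), and its form inherits nondegeneracy and
  skewsymmetry.
\<close>

section \<open>Bilinear maps and polynomial mappings\<close>

lemma bilinear_map_iff:
  "bilinear_map s1 s2 s3 h \<longleftrightarrow>
     vector_space s1 \<and> vector_space s2 \<and> vector_space s3 \<and>
     (\<forall>x x' y. h (x + x') y = h x y + h x' y) \<and> (\<forall>x y y'. h x (y + y') = h x y + h x y') \<and>
     (\<forall>c x y. h (s1 c x) y = s3 c (h x y)) \<and> (\<forall>c x y. h x (s2 c y) = s3 c (h x y))"
  by (auto simp: bilinear_map_def module_hom_iff_linear[symmetric] module_hom_iff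
      module_iff_vector_space)

lemma bilinear_mapD:
  assumes "bilinear_map s1 s2 s3 h"
  shows "h (x + x') y = h x y + h x' y" "h x (y + y') = h x y + h x y'"
    and "h (s1 c x) y = s3 c (h x y)" "h x (s2 c y) = s3 c (h x y)"
    and "h (- x) y = - h x y" "h x (- y) = - h x y"
    and "h (x - x') y = h x y - h x' y" "h x (y - y') = h x y - h x y'"
    and "h (sum g T) y = (\<Sum>t\<in>T. h (g t) y)" "h x (sum g' T) = (\<Sum>t\<in>T. h x (g' t))"
    and "h 0 y = 0" "h x 0 = 0"
proof -
  have l: "additive (\<lambda>x. h x y)" and r: "additive (h x)"
    using assms by (simp_all add: bilinear_map_iff additive_def)
  show "h (x + x') y = h x y + h x' y" "h x (y + y') = h x y + h x y'"
    "h (s1 c x) y = s3 c (h x y)" "h x (s2 c y) = s3 c (h x y)"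
    using assms by (simp_all add: bilinear_map_iff)
  show "h (- x) y = - h x y" "h (x - x') y = h x y - h x' y"
    "h (sum g T) y = (\<Sum>t\<in>T. h (g t) y)" "h 0 y = 0"
    using additive.minus[OF l] additive.diff[OF l] additive.sum[OF l] additive.zero[OF l] by auto
  show "h x (- y) = - h x y" "h x (y - y') = h x y - h x y'"
    "h x (sum g' T) = (\<Sum>t\<in>T. h x (g' t))" "h x 0 = 0"
    using additive.minus[OF r] additive.diff[OF r] additive.sum[OF r] additive.zero[OF r] by auto
qed

lemma poly_mapping_eq_sum_single:
  "(x :: 'x \<Rightarrow>\<^sub>0 'b::comm_monoid_add) =
     (\<Sum>k\<in>Poly_Mapping.keys x. Poly_Mapping.single k (Poly_Mapping.lookup x k))"
  by (rule poly_mapping_eqI)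
    (simp add: lookup_sum lookup_single when_def in_keys_iff)

lemma poly_mapping_add_induct [case_names zero single add]:
  fixes x :: "'x \<Rightarrow>\<^sub>0 'b::comm_monoid_add"
  assumes "P 0" and "\<And>k v. P (Poly_Mapping.single k v)" and "\<And>x y. P x \<Longrightarrow> P y \<Longrightarrow> P (x + y)"
  shows "P x"
proof -
  have "P (\<Sum>k\<in>K. Poly_Mapping.single k (Poly_Mapping.lookup x k))" for K
    by (induction K rule: infinite_finite_induct) (auto intro: assms)
  then show ?thesis
    by (metis poly_mapping_eq_sum_single)
qed

section \<open>Tensors and the functionals that separate them\<close>

lemma lookup_free_scale [simp]:
  "Poly_Mapping.lookup (free_scale c u) k = c * Poly_Mapping.lookup u k"
  by (simp add: free_scale_def Poly_Mapping.map.rep_eq when_def)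

lemma vector_space_free_scale: "vector_space (free_scale :: 'k::field \<Rightarrow> ('x \<Rightarrow>\<^sub>0 'k) \<Rightarrow> _)"
  by unfold_locales (auto intro!: poly_mapping_eqI simp: lookup_add algebra_simps)

interpretation free: vector_space "free_scale :: 'k::field \<Rightarrow> ('x \<Rightarrow>\<^sub>0 'k) \<Rightarrow> _"
  by (rule vector_space_free_scale)

lemma free_scale_single [simp]:
  "free_scale c (Poly_Mapping.single k d) = Poly_Mapping.single k (c * d)"
  by (rule poly_mapping_eqI) (simp add: lookup_single when_def)

definition free_ext :: "('x \<Rightarrow> 'k::field) \<Rightarrow> ('x \<Rightarrow>\<^sub>0 'k) \<Rightarrow> 'k" where
  "free_ext g u = (\<Sum>k\<in>Poly_Mapping.keys u. Poly_Mapping.lookup u k * g k)"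

lemma free_ext_superset:
  assumes "finite K" "Poly_Mapping.keys u \<subseteq> K"
  shows "free_ext g u = (\<Sum>k\<in>K. Poly_Mapping.lookup u k * g k)"
  unfolding free_ext_def
  by (rule sum.mono_neutral_left) (use assms in \<open>auto simp: in_keys_iff\<close>)

lemma free_ext_add: "free_ext g (u + v) = free_ext g u + free_ext g v"
proof -
  have "Poly_Mapping.keys (u + v) \<subseteq> Poly_Mapping.keys u \<union> Poly_Mapping.keys v" by (rule keys_add)
  then show ?thesis
    by (simp add: free_ext_superset[of "Poly_Mapping.keys u \<union> Poly_Mapping.keys v"]
        lookup_add algebra_simps sum.distrib)
qed

lemma free_ext_scale: "free_ext g (free_scale c u) = c * free_ext g u"
proof -
  have "Poly_Mapping.keys (free_scale c u) \<subseteq> Poly_Mapping.keys u" by (auto simp: in_keys_iff)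
  then show ?thesis
    by (simp add: free_ext_superset[of "Poly_Mapping.keys u"] sum_distrib_left mult.assoc)
qed

lemma additive_free_ext: "additive (free_ext g)"
  by (simp add: additive_def free_ext_add)

lemmas free_ext_simps = free_ext_add free_ext_scale additive.zero[OF additive_free_ext]
  additive.minus[OF additive_free_ext] additive.diff[OF additive_free_ext]
  additive.sum[OF additive_free_ext]

lemma free_ext_single [simp]: "free_ext g (Poly_Mapping.single k c) = c * g k"
  by (subst free_ext_superset[of "{k}"]) (auto simp: free_ext_simps)

lemma free_ext_pure2 [simp]: "free_ext g (pure2 x y) = g (x, y)"
  by (simp add: pure2_def)

lemma free_ext_pure3 [simp]: "free_ext g (pure3 x y z) = g (x, y, z)"
  by (simp add: pure3_def)

lemma free_ext_span_zero:
  assumes "\<And>u. u \<in> R \<Longrightarrow> free_ext g u = 0" and "u \<in> free.span R"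
  shows "free_ext g u = 0"
  using assms(2) by (induction rule: free.span_induct_alt) (auto simp: free_ext_simps assms(1))

text \<open>
  A pure tensor, viewed as a function of one factor, is additive and homogeneous only modulo the
  tensor relations. Working modulo a subspace \<open>M\<close> makes it possible to expand one factor at a
  time without forming the quotient.
\<close>

lemma linear_modulo_sum:
  fixes h :: "'v::ab_group_add \<Rightarrow> ('x \<Rightarrow>\<^sub>0 'k::field)"
  assumes s: "vector_space s" and V: "module.subspace s V" and M: "free.subspace M"
    and add: "\<And>x x'. x \<in> V \<Longrightarrow> x' \<in> V \<Longrightarrow> h (x + x') - h x - h x' \<in> M"
    and scale: "\<And>c x. x \<in> V \<Longrightarrow> h (s c x) - free_scale c (h x) \<in> M"
    and e: "\<And>t. t \<in> T \<Longrightarrow> e t \<in> V"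
  shows "h (\<Sum>t\<in>T. s (p t) (e t)) - (\<Sum>t\<in>T. free_scale (p t) (h (e t))) \<in> M"
  using e
proof (induction T rule: infinite_finite_induct)
  interpret vector_space s by (fact s)
  have zero: "h 0 \<in> M"
    using scale[of 0 0] V by (simp add: subspace_0)
  { case (infinite T) then show ?case using zero by simp }
  { case empty then show ?case using zero by simp }
  case (insert t T)
  let ?S = "\<Sum>t\<in>T. s (p t) (e t)"
  have "?S \<in> V"
    by (rule subspace_sum[OF V]) (use insert V in \<open>auto intro: subspace_scale\<close>)
  then have "h (s (p t) (e t) + ?S) - h (s (p t) (e t)) - h ?S \<in> M"
    using insert by (intro add) (auto intro: subspace_scale[OF V])
  moreover have "h (s (p t) (e t)) - free_scale (p t) (h (e t)) \<in> M"
    using insert by (intro scale) auto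
  ultimately have "(h (s (p t) (e t) + ?S) - h (s (p t) (e t)) - h ?S)
      + (h (s (p t) (e t)) - free_scale (p t) (h (e t)))
      + (h ?S - (\<Sum>t\<in>T. free_scale (p t) (h (e t)))) \<in> M"
    using insert M by (intro free.subspace_add[OF M]) auto
  then show ?case using insert by (simp add: algebra_simps)
qed

lemma sum_scale_congruent:
  assumes M: "free.subspace M" and "\<And>t. t \<in> T \<Longrightarrow> u t - v t \<in> M"
  shows "(\<Sum>t\<in>T. free_scale (p t) (u t)) - (\<Sum>t\<in>T. free_scale (p t) (v t)) \<in> M"
  unfolding sum_subtractf[symmetric] free.scale_right_diff_distrib[symmetric]
  by (rule free.subspace_sum[OF M]) (use assms in \<open>auto intro: free.subspace_scale\<close>)

text \<open>
  The coordinates of \<open>x \<in> V\<close> in the family \<open>e\<close> are the values of the form against \<open>f\<close>. The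
  subspace \<open>V\<close> is a parameter because each graded piece of the affinization has such coordinates
  in a finite family, while the whole space
  need not.
\<close>

definition resolves ::
  "('k::field \<Rightarrow> 'v::ab_group_add \<Rightarrow> 'v) \<Rightarrow> ('v \<Rightarrow> 'v \<Rightarrow> 'k) \<Rightarrow> 'i set \<Rightarrow> 'v set
    \<Rightarrow> ('i \<Rightarrow> 'v) \<Rightarrow> ('i \<Rightarrow> 'v) \<Rightarrow> bool" where
  "resolves s B I V e f \<longleftrightarrow> module.subspace s V \<and> e ` I \<subseteq> V \<and>
     (\<forall>x\<in>V. x = (\<Sum>\<alpha>\<in>I. s (B x (f \<alpha>)) (e \<alpha>)))"

text \<open>
  The value on a tensor of the functional \<open>B _ a \<otimes> B _ b\<close>, and below that of its analogue in
  three factors.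
\<close>

definition pairing2 :: "('v \<Rightarrow> 'v \<Rightarrow> 'k::field) \<Rightarrow> (('v \<times> 'v) \<Rightarrow>\<^sub>0 'k) \<Rightarrow> 'v \<Rightarrow> 'v \<Rightarrow> 'k" where
  "pairing2 B u a b = free_ext (\<lambda>(x, y). B x a * B y b) u"

definition pairing3 ::
  "('v \<Rightarrow> 'v \<Rightarrow> 'k::field) \<Rightarrow> (('v \<times> 'v \<times> 'v) \<Rightarrow>\<^sub>0 'k) \<Rightarrow> 'v \<Rightarrow> 'v \<Rightarrow> 'v \<Rightarrow> 'k" where
  "pairing3 B u a b c = free_ext (\<lambda>(x, y, z). B x a * B y b * B z c) u"

lemma pairing2_simps [simp]:
  "pairing2 B (pure2 x y) a b = B x a * B y b"
  "pairing2 B (u + v) a b = pairing2 B u a b + pairing2 B v a b"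
  "pairing2 B (u - v) a b = pairing2 B u a b - pairing2 B v a b"
  "pairing2 B (- u) a b = - pairing2 B u a b"
  "pairing2 B (sum w T) a b = (\<Sum>t\<in>T. pairing2 B (w t) a b)"
  by (simp_all add: pairing2_def free_ext_simps)

lemma pairing3_simps [simp]:
  "pairing3 B (pure3 x y z) a b c = B x a * B y b * B z c"
  "pairing3 B (u + v) a b c = pairing3 B u a b c + pairing3 B v a b c"
  "pairing3 B (sum w T) a b c = (\<Sum>t\<in>T. pairing3 B (w t) a b c)"
  by (simp_all add: pairing3_def free_ext_simps)

lemma congruent_trans:
  assumes "free.subspace M" "u - v \<in> M" "v - w \<in> M"
  shows "u - w \<in> M"
  using free.subspace_add[OF assms] by simp

text \<open>
  If a linear map \<open>N\<close> fixes every generator modulo \<open>M\<close>, then it fixes every combination of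
  them modulo \<open>M\<close>; such a combination lies in \<open>M\<close> if \<open>N\<close> kills it. In the use below, \<open>N\<close> rewrites a tensor in a basis of pure tensors.
\<close>

lemma mem_subspace_if_normal_form_zero:
  fixes N :: "('x \<Rightarrow>\<^sub>0 'k::field) \<Rightarrow> ('x \<Rightarrow>\<^sub>0 'k)"
  assumes M: "free.subspace M" and K: "Poly_Mapping.keys u \<subseteq> K"
    and add: "\<And>u v. N (u + v) = N u + N v"
    and scale: "\<And>c u. N (free_scale c u) = free_scale c (N u)"
    and pure: "\<And>k. k \<in> K \<Longrightarrow> Poly_Mapping.single k 1 - N (Poly_Mapping.single k 1) \<in> M"
    and "N u = 0"
  shows "u \<in> M"
proof -
  have a: "additive N" using add by (simp add: additive_def)
  have "u =
      (\<Sum>k\<in>Poly_Mapping.keys u. free_scale (Poly_Mapping.lookup u k) (Poly_Mapping.single k 1))"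
    using poly_mapping_eq_sum_single[of u] by simp
  moreover have "N \<dots> =
      (\<Sum>k\<in>Poly_Mapping.keys u. free_scale (Poly_Mapping.lookup u k) (N (Poly_Mapping.single k 1)))"
    by (simp only: additive.sum[OF a] scale)
  moreover have "(\<Sum>k\<in>Poly_Mapping.keys u. free_scale (Poly_Mapping.lookup u k) (Poly_Mapping.single k 1))
      - (\<Sum>k\<in>Poly_Mapping.keys u. free_scale (Poly_Mapping.lookup u k) (N (Poly_Mapping.single k 1))) \<in> M"
    by (rule sum_scale_congruent[OF M]) (use K pure in auto)
  ultimately have "u - N u \<in> M" by simp
  then show ?thesis using \<open>N u = 0\<close> by simp
qed

lemma tensor2_relations_in_span:
  shows "x \<in> V \<Longrightarrow> x' \<in> V \<Longrightarrow> y \<in> W \<Longrightarrow>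
      pure2 (x + x') y - pure2 x y - pure2 x' y \<in> free.span (tensor2_relations s V W)"
    and "x \<in> V \<Longrightarrow> y \<in> W \<Longrightarrow> y' \<in> W \<Longrightarrow>
      pure2 x (y + y') - pure2 x y - pure2 x y' \<in> free.span (tensor2_relations s V W)"
    and "x \<in> V \<Longrightarrow> y \<in> W \<Longrightarrow>
      pure2 (s c x) y - free_scale c (pure2 x y) \<in> free.span (tensor2_relations s V W)"
    and "x \<in> V \<Longrightarrow> y \<in> W \<Longrightarrow>
      pure2 x (s c y) - free_scale c (pure2 x y) \<in> free.span (tensor2_relations s V W)"
  by (rule free.span_base; unfold tensor2_relations_def; blast)+

lemma tensor3_relations_in_span:
  shows "x \<in> U \<Longrightarrow> x' \<in> U \<Longrightarrow> y \<in> V \<Longrightarrow> z \<in> W \<Longrightarrow>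
      pure3 (x + x') y z - pure3 x y z - pure3 x' y z \<in> free.span (tensor3_relations s U V W)"
    and "x \<in> U \<Longrightarrow> y \<in> V \<Longrightarrow> y' \<in> V \<Longrightarrow> z \<in> W \<Longrightarrow>
      pure3 x (y + y') z - pure3 x y z - pure3 x y' z \<in> free.span (tensor3_relations s U V W)"
    and "x \<in> U \<Longrightarrow> y \<in> V \<Longrightarrow> z \<in> W \<Longrightarrow> z' \<in> W \<Longrightarrow>
      pure3 x y (z + z') - pure3 x y z - pure3 x y z' \<in> free.span (tensor3_relations s U V W)"
    and "x \<in> U \<Longrightarrow> y \<in> V \<Longrightarrow> z \<in> W \<Longrightarrow>
      pure3 (s c x) y z - free_scale c (pure3 x y z) \<in> free.span (tensor3_relations s U V W)"
    and "x \<in> U \<Longrightarrow> y \<in> V \<Longrightarrow> z \<in> W \<Longrightarrow>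
      pure3 x (s c y) z - free_scale c (pure3 x y z) \<in> free.span (tensor3_relations s U V W)"
    and "x \<in> U \<Longrightarrow> y \<in> V \<Longrightarrow> z \<in> W \<Longrightarrow>
      pure3 x y (s c z) - free_scale c (pure3 x y z) \<in> free.span (tensor3_relations s U V W)"
  by (rule free.span_base; unfold tensor3_relations_def Un_iff mem_Collect_eq; fast)+

text \<open>
  The pairing functionals annihilate the tensor relations. Conversely, expanding both factors in
  the bases \<open>e1\<close>, \<open>e2\<close> writes a tensor, modulo the relations, as the combination of the basis
  tensors whose coefficients are its pairings with \<open>f1\<close>, \<open>f2\<close>; so vanishing pairings force it to
  be zero. The sets \<open>U'\<close>, \<open>V'\<close> of test vectors only have to contain the dual bases,
  which leaves room to test against whatever set is most convenient.
\<close>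

lemma tensor2_eq_iff_pairing:
  fixes s :: "'k::field \<Rightarrow> 'v::ab_group_add \<Rightarrow> 'v"
  assumes B: "bilinear_form s B"
    and U: "resolves s B I U e1 f1" and V: "resolves s B I V e2 f2"
    and "f1 ` I \<subseteq> U'" "f2 ` I \<subseteq> V'"
    and keys: "Poly_Mapping.keys u \<subseteq> U \<times> V" "Poly_Mapping.keys v \<subseteq> U \<times> V"
  shows "tensor2_eq s U V u v \<longleftrightarrow> (\<forall>a\<in>U'. \<forall>b\<in>V'. pairing2 B u a b = pairing2 B v a b)"
proof
  note bil = B[unfolded bilinear_form_def]
  assume "tensor2_eq s U V u v"
  then have "u - v \<in> free.span (tensor2_relations s U V)" by (simp add: tensor2_eq_def)
  then have "pairing2 B (u - v) a b = 0" for a b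
    unfolding pairing2_def
    by (rule free_ext_span_zero[rotated])
      (auto simp: tensor2_relations_def free_ext_simps bilinear_mapD[OF bil] ring_distribs mult_ac)
  then show "\<forall>a\<in>U'. \<forall>b\<in>V'. pairing2 B u a b = pairing2 B v a b" by simp
next
  have s: "vector_space s" using B by (simp add: bilinear_form_def bilinear_map_iff)
  let ?M = "free.span (tensor2_relations s U V)"
  have M: "free.subspace ?M" by simp
  let ?N = "\<lambda>u. \<Sum>\<alpha>\<in>I. \<Sum>\<beta>\<in>I. free_scale (pairing2 B u (f1 \<alpha>) (f2 \<beta>)) (pure2 (e1 \<alpha>) (e2 \<beta>))"
  assume "\<forall>a\<in>U'. \<forall>b\<in>V'. pairing2 B u a b = pairing2 B v a b"
  then have "pairing2 B u (f1 \<alpha>) (f2 \<beta>) = pairing2 B v (f1 \<alpha>) (f2 \<beta>)" if "\<alpha> \<in> I" "\<beta> \<in> I" for \<alpha> \<beta>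
    using that assms(4,5) by blast
  then have N0: "?N (u - v) = 0" by simp
  have pure: "pure2 x y - ?N (pure2 x y) \<in> ?M" if x: "x \<in> U" and y: "y \<in> V" for x y
  proof -
    let ?x = "\<Sum>\<alpha>\<in>I. s (B x (f1 \<alpha>)) (e1 \<alpha>)"
    let ?y = "\<Sum>\<beta>\<in>I. s (B y (f2 \<beta>)) (e2 \<beta>)"
    have eqs: "?x = x" "?y = y"
      using U V x y by (auto simp: resolves_def)
    have 1: "pure2 ?x y
        - (\<Sum>\<alpha>\<in>I. free_scale (B x (f1 \<alpha>)) (pure2 (e1 \<alpha>) y)) \<in> ?M"
      by (rule linear_modulo_sum[OF s, where V = U])
        (use U y in \<open>auto simp: resolves_def intro!: tensor2_relations_in_span\<close>)
    have 2: "(\<Sum>\<alpha>\<in>I. free_scale (B x (f1 \<alpha>)) (pure2 (e1 \<alpha>) ?y))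
       - (\<Sum>\<alpha>\<in>I. free_scale (B x (f1 \<alpha>))
            (\<Sum>\<beta>\<in>I. free_scale (B y (f2 \<beta>)) (pure2 (e1 \<alpha>) (e2 \<beta>)))) \<in> ?M"
      by (intro sum_scale_congruent[OF M] linear_modulo_sum[OF s, where V = V])
        (use U V x in \<open>auto simp: resolves_def intro!: tensor2_relations_in_span\<close>)
    show ?thesis
      using congruent_trans[OF M 1[unfolded eqs] 2[unfolded eqs]]
      by (simp add: free.scale_sum_right)
  qed
  have "Poly_Mapping.keys (u - v) \<subseteq> U \<times> V" using keys_diff[of u v] keys by blast
  then have "u - v \<in> ?M"
    by (rule mem_subspace_if_normal_form_zero[OF M, where N = ?N])
      (use pure N0 in \<open>auto simp: pairing2_def free_ext_simps free.scale_left_distrib sum.distrib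
          free.scale_sum_right pure2_def[symmetric]\<close>)
  then show "tensor2_eq s U V u v" by (simp add: tensor2_eq_def)
qed

text \<open>
  The argument for two factors, with one more factor to expand.
\<close>

lemma tensor3_eq_iff_pairing:
  fixes s :: "'k::field \<Rightarrow> 'v::ab_group_add \<Rightarrow> 'v"
  assumes B: "bilinear_form s B"
    and U: "resolves s B I U e1 f1" and V: "resolves s B I V e2 f2" and W: "resolves s B I W e3 f3"
    and "f1 ` I \<subseteq> U'" "f2 ` I \<subseteq> V'" "f3 ` I \<subseteq> W'"
    and keys: "Poly_Mapping.keys u \<subseteq> U \<times> V \<times> W"
  shows "tensor3_eq s U V W u 0 \<longleftrightarrow> (\<forall>a\<in>U'. \<forall>b\<in>V'. \<forall>c\<in>W'. pairing3 B u a b c = 0)"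
proof
  note bil = B[unfolded bilinear_form_def]
  assume "tensor3_eq s U V W u 0"
  then have "u \<in> free.span (tensor3_relations s U V W)" by (simp add: tensor3_eq_def)
  then have "pairing3 B u a b c = 0" for a b c
    unfolding pairing3_def
    by (rule free_ext_span_zero[rotated])
      (auto simp: tensor3_relations_def free_ext_simps bilinear_mapD[OF bil] ring_distribs mult_ac)
  then show "\<forall>a\<in>U'. \<forall>b\<in>V'. \<forall>c\<in>W'. pairing3 B u a b c = 0" by simp
next
  have s: "vector_space s" using B by (simp add: bilinear_form_def bilinear_map_iff)
  let ?M = "free.span (tensor3_relations s U V W)"
  have M: "free.subspace ?M" by simp
  let ?N = "\<lambda>u. \<Sum>\<alpha>\<in>I. \<Sum>\<beta>\<in>I. \<Sum>\<gamma>\<in>I.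
    free_scale (pairing3 B u (f1 \<alpha>) (f2 \<beta>) (f3 \<gamma>)) (pure3 (e1 \<alpha>) (e2 \<beta>) (e3 \<gamma>))"
  assume "\<forall>a\<in>U'. \<forall>b\<in>V'. \<forall>c\<in>W'. pairing3 B u a b c = 0"
  then have "pairing3 B u (f1 \<alpha>) (f2 \<beta>) (f3 \<gamma>) = 0" if "\<alpha> \<in> I" "\<beta> \<in> I" "\<gamma> \<in> I" for \<alpha> \<beta> \<gamma>
    using that assms(5-7) by blast
  then have N0: "?N u = 0" by simp
  have pure: "pure3 x y z - ?N (pure3 x y z) \<in> ?M"
    if x: "x \<in> U" and y: "y \<in> V" and z: "z \<in> W" for x y z
  proof -
    let ?x = "\<Sum>\<alpha>\<in>I. s (B x (f1 \<alpha>)) (e1 \<alpha>)"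
    let ?y = "\<Sum>\<beta>\<in>I. s (B y (f2 \<beta>)) (e2 \<beta>)"
    let ?z = "\<Sum>\<gamma>\<in>I. s (B z (f3 \<gamma>)) (e3 \<gamma>)"
    have eqs: "?x = x" "?y = y" "?z = z"
      using U V W x y z by (auto simp: resolves_def)
    have 1: "pure3 ?x y z - (\<Sum>\<alpha>\<in>I. free_scale (B x (f1 \<alpha>)) (pure3 (e1 \<alpha>) y z)) \<in> ?M"
      by (rule linear_modulo_sum[OF s, where V = U])
        (use U y z in \<open>auto simp: resolves_def intro!: tensor3_relations_in_span\<close>)
    have 2: "(\<Sum>\<alpha>\<in>I. free_scale (B x (f1 \<alpha>)) (pure3 (e1 \<alpha>) ?y z))
       - (\<Sum>\<alpha>\<in>I. free_scale (B x (f1 \<alpha>))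
            (\<Sum>\<beta>\<in>I. free_scale (B y (f2 \<beta>)) (pure3 (e1 \<alpha>) (e2 \<beta>) z))) \<in> ?M"
      by (intro sum_scale_congruent[OF M] linear_modulo_sum[OF s, where V = V])
        (use U V x z in \<open>auto simp: resolves_def intro!: tensor3_relations_in_span\<close>)
    have 3: "(\<Sum>\<alpha>\<in>I. free_scale (B x (f1 \<alpha>))
            (\<Sum>\<beta>\<in>I. free_scale (B y (f2 \<beta>)) (pure3 (e1 \<alpha>) (e2 \<beta>) ?z)))
       - (\<Sum>\<alpha>\<in>I. free_scale (B x (f1 \<alpha>)) (\<Sum>\<beta>\<in>I. free_scale (B y (f2 \<beta>))
            (\<Sum>\<gamma>\<in>I. free_scale (B z (f3 \<gamma>)) (pure3 (e1 \<alpha>) (e2 \<beta>) (e3 \<gamma>))))) \<in> ?M"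
      by (intro sum_scale_congruent[OF M] linear_modulo_sum[OF s, where V = W])
        (use U V W x in \<open>auto simp: resolves_def intro!: tensor3_relations_in_span\<close>)
    show ?thesis
      using congruent_trans[OF M congruent_trans[OF M 1[unfolded eqs] 2[unfolded eqs]]
        3[unfolded eqs]]
      by (simp add: free.scale_sum_right mult.assoc)
  qed
  show "tensor3_eq s U V W u 0"
    unfolding tensor3_eq_def diff_zero
    by (rule mem_subspace_if_normal_form_zero[OF M keys, where N = ?N])
      (use pure N0 in \<open>auto simp: pairing3_def free_ext_simps free.scale_left_distrib sum.distrib
          free.scale_sum_right pure3_def[symmetric]\<close>)
qed

section \<open>The affinization of a Novikov algebra\<close>

lemma lookup_aff_scale:
  assumes "vector_space s"
  shows "Poly_Mapping.lookup (aff_scale s c x) k = s c (Poly_Mapping.lookup x k)"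
proof -
  interpret vector_space s by fact
  show ?thesis by (simp add: aff_scale_def Poly_Mapping.map.rep_eq when_def)
qed

lemma vector_space_aff_scale:
  assumes "vector_space s"
  shows "vector_space (aff_scale s)"
proof -
  interpret vector_space s by fact
  show ?thesis
    by unfold_locales
      (auto intro!: poly_mapping_eqI simp: lookup_aff_scale[OF assms] lookup_add algebra_simps)
qed

lemma aff_scale_monom:
  assumes "vector_space s"
  shows "aff_scale s c (aff_monom a i) = aff_monom (s c a) i"
proof -
  interpret vector_space s by fact
  show ?thesis
    by (rule poly_mapping_eqI)
      (simp add: lookup_aff_scale[OF assms] aff_monom_def lookup_single when_def)
qed

lemma aff_monom_add: "aff_monom (a + b) i = aff_monom a i + aff_monom b i"
  by (simp add: aff_monom_def single_add)

lemma additive_aff_monom: "additive (\<lambda>a. aff_monom a i)"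
  by (simp add: additive_def aff_monom_add)

lemmas aff_monom_simps = aff_monom_add additive.zero[OF additive_aff_monom]
  additive.minus[OF additive_aff_monom] additive.diff[OF additive_aff_monom]
  additive.sum[OF additive_aff_monom]

lemma aff_monom_eq_zero_iff [simp]: "aff_monom a i = 0 \<longleftrightarrow> a = 0"
  by (metis aff_monom_def lookup_single_eq lookup_zero single_zero)

text \<open>
  The sums run over supports that depend on the arguments. Since every \<open>g i j\<close> vanishes when an
  argument is zero, they may be extended to a common finite set, on which linearity is termwise.
\<close>

lemma bilinear_map_aff_extension:
  assumes g: "\<And>i j. bilinear_map s s s3 (g i j)"
  shows "bilinear_map (aff_scale s) (aff_scale s) s3
    (\<lambda>x y. \<Sum>i\<in>Poly_Mapping.keys x. \<Sum>j\<in>Poly_Mapping.keys y.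
        g i j (Poly_Mapping.lookup x i) (Poly_Mapping.lookup y j))"
    (is "bilinear_map _ _ _ ?h")
proof -
  have s: "vector_space s" and s3: "vector_space s3" using g by (simp_all add: bilinear_map_iff)
  interpret s: vector_space s by (fact s)
  interpret s3: vector_space s3 by (fact s3)
  note g' = bilinear_mapD[OF g]
  have sup: "?h x y = (\<Sum>i\<in>K. \<Sum>j\<in>M. g i j (Poly_Mapping.lookup x i) (Poly_Mapping.lookup y j))"
    if "finite K" "finite M" "Poly_Mapping.keys x \<subseteq> K" "Poly_Mapping.keys y \<subseteq> M" for x y K M
  proof -
    have "?h x y = (\<Sum>i\<in>Poly_Mapping.keys x. \<Sum>j\<in>M.
        g i j (Poly_Mapping.lookup x i) (Poly_Mapping.lookup y j))"
      by (intro sum.cong refl sum.mono_neutral_left) (use that in \<open>auto simp: in_keys_iff g'\<close>)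
    also have "\<dots> = (\<Sum>i\<in>K. \<Sum>j\<in>M. g i j (Poly_Mapping.lookup x i) (Poly_Mapping.lookup y j))"
      by (intro sum.mono_neutral_left) (use that in \<open>auto simp: in_keys_iff g'\<close>)
    finally show ?thesis .
  qed
  have "?h (x + x') y = ?h x y + ?h x' y" for x x' y
  proof -
    let ?K = "\<Union>v\<in>{x, x', x + x'}. Poly_Mapping.keys v"
    have e: "?h v y = (\<Sum>i\<in>?K. \<Sum>j\<in>Poly_Mapping.keys y.
        g i j (Poly_Mapping.lookup v i) (Poly_Mapping.lookup y j))" if "v \<in> {x, x', x + x'}" for v
      by (rule sup) (use that in auto)
    show ?thesis
      unfolding e[OF insertI1] e[OF insertI2[OF insertI1]] 
        e[OF insertI2[OF insertI2[OF insertI1]]]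
      by (simp add: lookup_add g' sum.distrib)
  qed
  moreover have "?h x (y + y') = ?h x y + ?h x y'" for x y y'
  proof -
    let ?K = "\<Union>v\<in>{y, y', y + y'}. Poly_Mapping.keys v"
    have e: "?h x v = (\<Sum>i\<in>Poly_Mapping.keys x. \<Sum>j\<in>?K.
        g i j (Poly_Mapping.lookup x i) (Poly_Mapping.lookup v j))" if "v \<in> {y, y', y + y'}" for v
      by (rule sup) (use that in auto)
    show ?thesis
      unfolding e[OF insertI1] e[OF insertI2[OF insertI1]] 
        e[OF insertI2[OF insertI2[OF insertI1]]]
      by (simp add: lookup_add g' sum.distrib)
  qed
  moreover have keys: "Poly_Mapping.keys (aff_scale s c x) \<subseteq> Poly_Mapping.keys x" for c x
    by (auto simp: in_keys_iff lookup_aff_scale[OF s])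
  have "?h (aff_scale s c x) y = s3 c (?h x y)" for c x y
    by (subst sup[of "Poly_Mapping.keys x" "Poly_Mapping.keys y"])
      (use keys[of c x] in \<open>simp_all add: lookup_aff_scale[OF s] g' s3.scale_sum_right\<close>)
  moreover have "?h x (aff_scale s c y) = s3 c (?h x y)" for c x y
    by (subst sup[of "Poly_Mapping.keys x" "Poly_Mapping.keys y"])
      (use keys[of c y] in \<open>simp_all add: lookup_aff_scale[OF s] g' s3.scale_sum_right\<close>)
  ultimately show ?thesis
    using vector_space_aff_scale[OF s] s3 by (simp add: bilinear_map_iff)
qed

lemma bilinear_map_aff_bracket:
  assumes "novikov_algebra s m"
  shows "bilinear_map (aff_scale s) (aff_scale s) (aff_scale s) (aff_bracket s m)"
proof -
  have s: "vector_space s" and m: "bilinear_map s s s m"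
    using assms by (auto simp: novikov_algebra_def)
  interpret s: vector_space s by (fact s)
  interpret L: vector_space "aff_scale s" by (rule vector_space_aff_scale[OF s])
  show ?thesis
    unfolding aff_bracket_def
  proof (rule bilinear_map_aff_extension)
    fix i j
    show "bilinear_map s s (aff_scale s) (\<lambda>x y. aff_monom (s (of_int i) (m x y)) (i + j - 1)
        - aff_monom (s (of_int j) (m y x)) (i + j - 1))"
      unfolding bilinear_map_iff
      by (intro conjI allI s L.vector_space_axioms)
        (simp_all only: bilinear_mapD(1-4)[OF m] s.scale_right_distrib aff_monom_add
          L.scale_right_diff_distrib aff_scale_monom[OF s] s.scale_scale mult.commute add_diff_add)
  qed
qed

lemma bilinear_form_aff_form:
  assumes "bilinear_form s \<omega>"
  shows "bilinear_form (aff_scale s) (aff_form \<omega>)"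
proof -
  note w = assms[unfolded bilinear_form_def]
  show ?thesis
    unfolding bilinear_form_def aff_form_def
    by (rule bilinear_map_aff_extension)
      (use w in \<open>simp add: bilinear_map_iff distrib_right\<close>)
qed

lemma aff_induct [case_names zero monom add]:
  fixes x :: "int \<Rightarrow>\<^sub>0 'b::comm_monoid_add"
  assumes "P 0" and "\<And>a i. P (aff_monom a i)" and "\<And>x y. P x \<Longrightarrow> P y \<Longrightarrow> P (x + y)"
  shows "P x"
  using assms unfolding aff_monom_def by (rule poly_mapping_add_induct)

lemma biadditive_aff_zero:
  assumes "\<And>y. additive (\<lambda>x. T x y)" "\<And>x. additive (T x)"
    and "\<And>a b i j. T (aff_monom a i) (aff_monom b j) = 0"
  shows "T x y = 0"
proof (induction x rule: aff_induct)
  case (monom a i)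
  show ?case
    by (induction y rule: aff_induct)
      (simp_all add: assms(3) additive.zero[OF assms(2)] additive.add[OF assms(2)])
qed (simp_all add: additive.zero[OF assms(1)] additive.add[OF assms(1)])

text \<open>
  The Jacobi identity and the cyclic identity of the form are triadditive expressions, so it is
  enough to check them on monomials.
\<close>

lemma triadditive_aff_zero:
  assumes "\<And>y z. additive (\<lambda>x. T x y z)" "\<And>x z. additive (\<lambda>y. T x y z)" "\<And>x y. additive (T x y)"
    and "\<And>a b c i j k. T (aff_monom a i) (aff_monom b j) (aff_monom c k) = 0"
  shows "T x y z = 0"
proof (induction x rule: aff_induct)
  case (monom a i)
  show ?case
    by (rule biadditive_aff_zero[where T = "T (aff_monom a i)"]) (use assms in auto)
qed (simp_all add: additive.zero[OF assms(1)] additive.add[OF assms(1)])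

text \<open>
  On monomials, the Jacobi sum is a combination of twelve triple products. Right commutativity
  leaves three different products \<open>(x y) z\<close>, and left symmetry expresses three of the products
  \<open>x (y z)\<close> through the other products; the integer coefficients then cancel.
\<close>

lemma lie_algebra_affinization:
  assumes N: "novikov_algebra s m"
  shows "lie_algebra (aff_scale s) (aff_bracket s m)"
proof -
  have s: "vector_space s" and m: "bilinear_map s s s m"
    and ls: "\<And>a b c. m (m a b) c - m a (m b c) = m (m b a) c - m b (m a c)"
    and rc: "\<And>a b c. m (m a b) c = m (m a c) b"
    using N by (auto simp: novikov_algebra_def)
  interpret s: vector_space s by (fact s)
  let ?b = "aff_bracket s m"
  note bil = bilinear_map_aff_bracket[OF N]
  note br = bilinear_mapD[OF bil]
  note mm = bilinear_mapD[OF m]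
  have "?b x x = 0" for x
    unfolding aff_bracket_def sum_subtractf
    by (subst (2) sum.swap) (simp add: add.commute)
  moreover have "?b x (?b y z) + ?b y (?b z x) + ?b z (?b x y) = 0" for x y z
  proof (rule triadditive_aff_zero
      [where T = "\<lambda>x y z. ?b x (?b y z) + ?b y (?b z x) + ?b z (?b x y)"])
    fix a b c :: 'b and i j k :: int
    have 1: "m b (m a c) = m a (m b c) - m (m a b) c + m (m b a) c"
      using ls[of a b c] by (simp add: algebra_simps)
    have 2: "m c (m b a) = m b (m c a) - m (m b a) c + m (m c a) b"
      using ls[of b c a] rc[of b c a] rc[of c b a] by (simp add: algebra_simps)
    have 3: "m c (m a b) = m a (m c b) - m (m a b) c + m (m c a) b"
      using ls[of a c b] rc[of a c b] by (simp add: algebra_simps)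
    have 4: "m (m a c) b = m (m a b) c" "m (m b c) a = m (m b a) c" "m (m c b) a = m (m c a) b"
      by (rule rc)+
    have e: "j + (k + i - 1) - 1 = i + (j + k - 1) - 1" "k + (i + j - 1) - 1 = i + (j + k - 1) - 1"
      by simp_all
    show "?b (aff_monom a i) (?b (aff_monom b j) (aff_monom c k))
      + ?b (aff_monom b j) (?b (aff_monom c k) (aff_monom a i))
      + ?b (aff_monom c k) (?b (aff_monom a i) (aff_monom b j)) = 0"
      unfolding aff_bracket_monom[OF N] br mm e aff_monom_simps(4)[symmetric]
        aff_monom_add[symmetric]        1 2 3 4
      by (simp add: algebra_simps)
  qed (simp_all add: additive_def br)
  ultimately show ?thesis
    using bil by (simp add: lie_algebra_def vector_space_aff_scale[OF s])
qed

lemma subspace_aff_degree: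
  assumes "vector_space s"
  shows "module.subspace (aff_scale s) (aff_degree i)"
proof -
  interpret L: vector_space "aff_scale s" by (rule vector_space_aff_scale[OF assms])
  have "0 = aff_monom 0 (i + 1)" by simp
  then show ?thesis
    by (intro L.subspaceI)
      (auto simp: aff_degree_def aff_scale_monom[OF assms] aff_monom_add[symmetric]
        simp del: aff_monom_eq_zero_iff)
qed

lemma aff_monom_in_aff_degree: "aff_monom a i \<in> aff_degree j \<longleftrightarrow> a = 0 \<or> j = i - 1"
proof
  assume "aff_monom a i \<in> aff_degree j"
  then obtain b where "aff_monom a i = aff_monom b (j + 1)" by (auto simp: aff_degree_def)
  then have "Poly_Mapping.lookup (aff_monom a i) i = Poly_Mapping.lookup (aff_monom b (j + 1)) i"
    by simp
  then show "a = 0 \<or> j = i - 1"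
    by (auto simp: aff_monom_def lookup_single when_def split: if_splits)
next
  assume "a = 0 \<or> j = i - 1"
  then have "aff_monom a i = aff_monom a (j + 1)" by (auto simp: aff_monom_def)
  then show "aff_monom a i \<in> aff_degree j" unfolding aff_degree_def by blast
qed

lemma homogeneous_aff_monom: "homogeneous aff_degree (aff_monom a i)"
  unfolding homogeneous_def aff_monom_in_aff_degree by blast

lemma Z_grading_affinization:
  assumes "vector_space s"
  shows "Z_grading (aff_scale s) aff_degree"
  unfolding Z_grading_def
proof (intro conjI allI)
  fix x :: "int \<Rightarrow>\<^sub>0 'b"
  let ?ok = "\<lambda>d. (\<forall>i. d i \<in> aff_degree i) \<and> finite {i. d i \<noteq> 0} \<and> x = (\<Sum>i\<in>{i. d i \<noteq> 0}. d i)"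
  let ?d = "\<lambda>i. aff_monom (Poly_Mapping.lookup x (i + 1)) (i + 1)"
  show "\<exists>!d. ?ok d"
  proof (rule ex1I[of _ ?d])
    \<comment> \<open>The degree is one less than the exponent.\<close>
    have supp: "{i. ?d i \<noteq> 0} = (\<lambda>k. k - 1) ` Poly_Mapping.keys x"
      by (force simp: in_keys_iff image_iff)
    have "(\<Sum>i\<in>(\<lambda>k. k - 1) ` Poly_Mapping.keys x. ?d i) = x"
      using poly_mapping_eq_sum_single[of x]
      by (subst sum.reindex) (auto simp: inj_on_def aff_monom_def)
    then show "?ok ?d"
      unfolding supp by (auto simp: aff_degree_def)
  next
    fix d assume d: "?ok d"
    show "d = ?d"
    proof
      fix i
      obtain a where a: "\<And>j. d j = aff_monom (a j) (j + 1)"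
        using d unfolding aff_degree_def by simp metis
      have "Poly_Mapping.lookup x (i + 1) = (\<Sum>j\<in>{j. d j \<noteq> 0}. Poly_Mapping.lookup (d j) (i + 1))"
        using d by (metis lookup_sum)
      also have "\<dots> = (\<Sum>j\<in>{j. d j \<noteq> 0}. if j = i then a j else 0)"
        by (intro sum.cong) (auto simp: a aff_monom_def lookup_single when_def)
      also have "\<dots> = a i"
        using d by (simp add: a)
      finally show "d i = ?d i" by (simp add: a)
    qed
  qed
qed (rule subspace_aff_degree[OF assms])

section \<open>Contraction against dual bases\<close>

lemma form_contraction:
  assumes "bilinear_form s B"
  shows "(\<Sum>t\<in>T. p t * B (u t) x) = B (\<Sum>t\<in>T. s (p t) (u t)) x"
  by (simp add: bilinear_mapD[OF assms[unfolded bilinear_form_def]])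

text \<open>
  Contracting both arguments of a product at once: pairing off two legs of a Yang-Baxter term
  replaces the remaining legs by the vectors \<open>y\<close> and \<open>z\<close> that they resolve.
\<close>

lemma product_contraction:
  assumes "bilinear_form s B" and "bilinear_map s s s br"
    and "(\<Sum>t\<in>T. s (p t) (u t)) = y" "(\<Sum>t\<in>T. s (q t) (v t)) = z"
  shows "(\<Sum>t\<in>T. \<Sum>t'\<in>T. p t * q t' * B (br (u t) (v t')) x) = B (br y z) x"
proof -
  note B = bilinear_mapD[OF assms(1)[unfolded bilinear_form_def]]
  note br = bilinear_mapD[OF assms(2)]
  have "B (br y z) x = (\<Sum>t\<in>T. p t * (\<Sum>t'\<in>T. q t' * B (br (u t) (v t')) x))"
    unfolding assms(3,4)[symmetric] br(9) br(3) B(9) B(3)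
    unfolding br(10) br(4) B(9) B(3) ..
  then show ?thesis by (simp add: sum_distrib_left mult.assoc)
qed

lemma bilinear_map_star_product:
  assumes "bilinear_map s s s m"
  shows "bilinear_map s s s (star_product m)"
proof -
  have s: "vector_space s" using assms by (simp add: bilinear_map_iff)
  interpret vector_space s by (rule s)
  note m = bilinear_mapD(1-4)[OF assms]
  show ?thesis
    unfolding bilinear_map_iff star_product_def m
    by (simp add: s scale_right_distrib add_ac)
qed

text \<open>
  Test vectors that see a single degree: pairing a formal sum with them picks out one component.
\<close>

definition detects :: "('l \<Rightarrow> 'l \<Rightarrow> 'k::zero) \<Rightarrow> (int \<Rightarrow> 'l::zero set) \<Rightarrow> int \<Rightarrow> 'l \<Rightarrow> bool" where
  "detects B L i x \<longleftrightarrow> B 0 x = 0 \<and> (\<forall>j v. j \<noteq> i \<longrightarrow> v \<in> L j \<longrightarrow> B v x = 0)"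

lemma detects_nonzeroD:
  assumes "detects B L i x" "homogeneous L v" "B v x \<noteq> 0"
  shows "v \<in> L i - {0}"
  using assms by (auto simp: detects_def homogeneous_def)

text \<open>
  A term left out of the component has a zero factor or a factor in a degree that the test
  vector does not see, so its pairing is zero. The sum may therefore be taken over a larger set
  \<open>F\<close>, in the uses below a full box of indices, over which it can be contracted.
\<close>

lemma pairing2_component2:
  assumes "\<And>p. p \<in> P \<Longrightarrow> homogeneous L (a p)" "\<And>p. p \<in> P \<Longrightarrow> homogeneous L (b p)"
    and F: "finite F" "F \<subseteq> P" "terms2 L P a b i j \<subseteq> F"
    and "detects B L i x" "detects B L j y"
  shows "pairing2 B (component2 L P a b i j) x y = (\<Sum>p\<in>F. B (a p) x * B (b p) y)"
proof -
  have "B (a p) x * B (b p) y = 0" if "p \<in> F - terms2 L P a b i j" for p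
  proof (rule ccontr)
    assume "B (a p) x * B (b p) y \<noteq> 0"
    moreover have "p \<in> P" using that F(2) by auto
    ultimately have "p \<in> terms2 L P a b i j"
      using detects_nonzeroD[OF assms(6), of "a p"] detects_nonzeroD[OF assms(7), of "b p"]
        assms(1,2) by (simp add: terms2_def)
    then show False using that by simp
  qed
  then show ?thesis
    unfolding component2_def by (simp add: sum.mono_neutral_left[OF F(1,3)])
qed

lemma pairing3_component3:
  assumes "\<And>p. p \<in> P \<Longrightarrow> homogeneous L (a p) \<and> homogeneous L (b p) \<and> homogeneous L (c p)"
    and F: "finite F" "F \<subseteq> P" "terms3 L P a b c i j k \<subseteq> F"
    and "detects B L i x" "detects B L j y" "detects B L k z"
  shows "pairing3 B (component3 L P a b c i j k) x y z
    = (\<Sum>p\<in>F. B (a p) x * B (b p) y * B (c p) z)"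
proof -
  have "B (a p) x * B (b p) y * B (c p) z = 0" if "p \<in> F - terms3 L P a b c i j k" for p
  proof (rule ccontr)
    assume "B (a p) x * B (b p) y * B (c p) z \<noteq> 0"
    moreover have "p \<in> P" using that F(2) by auto
    ultimately have "p \<in> terms3 L P a b c i j k"
      using detects_nonzeroD[OF assms(5), of "a p"] detects_nonzeroD[OF assms(6), of "b p"]
        detects_nonzeroD[OF assms(7), of "c p"] assms(1) by (simp add: terms3_def)
    then show False using that by simp
  qed
  then show ?thesis
    unfolding component3_def by (simp add: sum.mono_neutral_left[OF F(1,3)])
qed

lemma keys_uminus: "Poly_Mapping.keys (- u) = Poly_Mapping.keys u"
  for u :: "'x \<Rightarrow>\<^sub>0 'b::ab_group_add"
  by (auto simp: in_keys_iff)

lemma keys_component2: "Poly_Mapping.keys (component2 L P a b i j) \<subseteq> L i \<times> L j"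
  unfolding component2_def
  by (rule order_trans[OF keys_sum]) (auto simp: terms2_def pure2_def)

lemma keys_component3: "Poly_Mapping.keys (component3 L P a b c i j k) \<subseteq> L i \<times> L j \<times> L k"
  unfolding component3_def
  by (rule order_trans[OF keys_sum]) (auto simp: terms3_def pure3_def)

section \<open>The equivalence of the four conditions\<close>

locale novikov_dual_bases =
  fixes scale :: "'k::field \<Rightarrow> 'a::ab_group_add \<Rightarrow> 'a"
    and mul :: "'a \<Rightarrow> 'a \<Rightarrow> 'a"
    and \<omega> :: "'a \<Rightarrow> 'a \<Rightarrow> 'k"
    and I :: "'i set"
    and e f :: "'i \<Rightarrow> 'a"
  assumes novikov: "novikov_algebra scale mul"
    and form: "bilinear_form scale \<omega>" and nondeg: "nondegenerate_form \<omega>"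
    and inj: "inj_on e I" and basis: "finite_dimensional_vector_space scale (e ` I)"
    and dual: "\<forall>\<alpha>\<in>I. \<forall>\<beta>\<in>I. \<omega> (e \<alpha>) (f \<beta>) = (if \<alpha> = \<beta> then 1 else 0)"
begin

sublocale A: finite_dimensional_vector_space scale "e ` I"
  by (rule basis)

abbreviation "L_scale \<equiv> aff_scale scale"
abbreviation "L_bracket \<equiv> aff_bracket scale mul"
abbreviation "L_form \<equiv> aff_form \<omega>"
text \<open>
  The two legs of \<open>r\<^sub>L\<close>, indexed by pairs \<open>(i, \<alpha>)\<close>.
\<close>

definition "left_leg = (\<lambda>(i :: int, \<alpha>). aff_monom (e \<alpha>) i)"
definition "right_leg = (\<lambda>(i :: int, \<alpha>). aff_monom (f \<alpha>) (- i - 1))"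
abbreviation "leg_indices \<equiv> (UNIV :: int set) \<times> I"

lemma finite_I: "finite I"
  using finite_imageD[OF A.finite_Basis inj] .

lemma bilinear_\<omega>: "bilinear_map scale scale (*) \<omega>"
  using form by (simp add: bilinear_form_def)

lemma bilinear_mul: "bilinear_map scale scale scale mul"
  using novikov by (simp add: novikov_algebra_def)

lemma vector_space_A: "vector_space scale"
  by (rule A.vector_space_axioms)

lemma expand_e: "(\<Sum>\<alpha>\<in>I. scale (\<omega> a (f \<alpha>)) (e \<alpha>)) = a"
proof -
  have "a \<in> A.span (e ` I)" by (simp add: A.span_Basis)
  then show ?thesis
  proof (induction rule: A.span_induct_alt)
    case base
    then show ?case by (simp add: bilinear_mapD[OF bilinear_\<omega>])
  next
    case (step c x y)
    then obtain \<beta> where \<beta>: "\<beta> \<in> I" "x = e \<beta>" by auto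
    have "(\<Sum>\<alpha>\<in>I. scale (\<omega> x (f \<alpha>)) (e \<alpha>)) = (\<Sum>\<alpha>\<in>I. if \<alpha> = \<beta> then e \<alpha> else 0)"
      by (intro sum.cong) (use dual \<beta> in auto)
    then have x: "(\<Sum>\<alpha>\<in>I. scale (\<omega> x (f \<alpha>)) (e \<alpha>)) = x"
      using \<beta> finite_I by simp
    have "(\<Sum>\<alpha>\<in>I. scale (\<omega> (scale c x + y) (f \<alpha>)) (e \<alpha>))
        = scale c (\<Sum>\<alpha>\<in>I. scale (\<omega> x (f \<alpha>)) (e \<alpha>)) + (\<Sum>\<alpha>\<in>I. scale (\<omega> y (f \<alpha>)) (e \<alpha>))"
      by (simp add: bilinear_mapD[OF bilinear_\<omega>] A.scale_left_distrib sum.distrib A.scale_sum_right)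
    then show ?case by (simp add: x step)
  qed
qed

text \<open>
  Both sides pair equally with every \<open>e \<beta>\<close>, hence with every vector, and the form is
  nondegenerate.
\<close>

lemma expand_f: "(\<Sum>\<alpha>\<in>I. scale (\<omega> (e \<alpha>) a) (f \<alpha>)) = a"
proof -
  note w = bilinear_mapD[OF bilinear_\<omega>]
  let ?d = "(\<Sum>\<alpha>\<in>I. scale (\<omega> (e \<alpha>) a) (f \<alpha>)) - a"
  have e0: "\<omega> (e \<beta>) ?d = 0" if "\<beta> \<in> I" for \<beta>
  proof -
    have "(\<Sum>\<alpha>\<in>I. \<omega> (e \<alpha>) a * \<omega> (e \<beta>) (f \<alpha>)) = (\<Sum>\<alpha>\<in>I. if \<alpha> = \<beta> then \<omega> (e \<alpha>) a else 0)"
      by (intro sum.cong) (use dual that in auto)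
    then show ?thesis using that finite_I by (simp add: w)
  qed
  have "\<omega> b ?d = 0" for b
  proof -
    have "\<omega> b ?d = \<omega> (\<Sum>\<alpha>\<in>I. scale (\<omega> b (f \<alpha>)) (e \<alpha>)) ?d" by (simp only: expand_e)
    also have "\<dots> = (\<Sum>\<alpha>\<in>I. \<omega> b (f \<alpha>) * \<omega> (e \<alpha>) ?d)" by (simp only: w(9) w(3))
    also have "\<dots> = 0" using e0 by simp
    finally show ?thesis .
  qed
  then have "?d = 0" using nondeg unfolding nondegenerate_form_def by blast
  then show ?thesis by simp
qed

lemma expand_e_skew:
  assumes "skewsymmetric_form \<omega>"
  shows "(\<Sum>\<alpha>\<in>I. scale (\<omega> (f \<alpha>) a) (e \<alpha>)) = - a"
proof -
  have "\<omega> (f \<alpha>) a = - \<omega> a (f \<alpha>)" for \<alpha>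
    using assms unfolding skewsymmetric_form_def by blast
  then show ?thesis by (simp add: expand_e sum_negf)
qed

lemma resolves_A: "resolves scale \<omega> I UNIV e f"
  by (simp add: resolves_def expand_e)

subsection \<open>Tensors over the Novikov algebra\<close>

lemma skewsymmetric_tensor_iff: "skewsymmetric_tensor scale I e f \<longleftrightarrow> skewsymmetric_form \<omega>"
proof -
  have "pairing2 \<omega> (\<Sum>p\<in>I. pure2 (f p) (e p)) a b = \<omega> b a" for a b
    using form_contraction[OF form, where p = "\<lambda>\<alpha>. \<omega> (e \<alpha>) b" and u = f and x = a and T = I]
    by (simp add: expand_f mult.commute)
  moreover have "pairing2 \<omega> (- (\<Sum>p\<in>I. pure2 (e p) (f p))) a b = - \<omega> a b" for a b
    using form_contraction[OF form, where p = "\<lambda>\<alpha>. \<omega> (e \<alpha>) a" and u = f and x = b and T = I]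
    by (simp add: expand_f)
  ultimately have "skewsymmetric_tensor scale I e f \<longleftrightarrow> (\<forall>a\<in>UNIV. \<forall>b\<in>UNIV. \<omega> b a = - \<omega> a b)"
    unfolding skewsymmetric_tensor_def
    by (subst tensor2_eq_iff_pairing[OF form resolves_A resolves_A, where U' = UNIV and V' = UNIV])
      (simp_all only: UNIV_Times_UNIV subset_UNIV)
  then show ?thesis unfolding skewsymmetric_form_def by blast
qed

definition novikov_cocycle :: bool where
  "novikov_cocycle \<longleftrightarrow>
     (\<forall>a b c. \<omega> (mul a b) c - \<omega> (star_product mul a c) b + \<omega> (mul c b) a = 0)"

lemma quasi_Frobenius_novikov_iff:
  "quasi_Frobenius_novikov scale mul \<omega> \<longleftrightarrow> skewsymmetric_form \<omega> \<and> novikov_cocycle"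
  using novikov form nondeg by (auto simp: quasi_Frobenius_novikov_def novikov_cocycle_def)

text \<open>
  Each term of the Novikov equation, paired with \<open>a \<otimes> b \<otimes> c\<close>, contracts to one term of the
  cocycle identity. A leg \<open>f\<close> that is paired off contributes a factor \<open>- 1\<close>, so the middle term,
  with one such leg, changes sign.
\<close>

lemma novikov_YBE_iff:
  assumes skew: "skewsymmetric_form \<omega>"
  shows "novikov_YBE scale mul I e f \<longleftrightarrow> novikov_cocycle"
proof -
  note w = bilinear_mapD[OF bilinear_\<omega>]
  note contract = product_contraction[OF form, where T = I]
  have 1: "(\<Sum>p\<in>I. \<Sum>q\<in>I. \<omega> (e p) a * \<omega> (e q) b * \<omega> (mul (f p) (f q)) c) = \<omega> (mul a b) c" for a b c
    by (rule contract[OF bilinear_mul expand_f expand_f])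
  have 2: "(\<Sum>p\<in>I. \<Sum>q\<in>I. \<omega> (e p) a * \<omega> (f q) c * \<omega> (star_product mul (f p) (e q)) b)
      = - \<omega> (star_product mul a c) b" for a b c
    using contract[OF bilinear_map_star_product[OF bilinear_mul] expand_f expand_e_skew[OF skew]]
    by (simp add: bilinear_mapD[OF bilinear_map_star_product[OF bilinear_mul]] w)
  have 3: "(\<Sum>p\<in>I. \<Sum>q\<in>I. \<omega> (f p) c * \<omega> (f q) b * \<omega> (mul (e p) (e q)) a) = \<omega> (mul c b) a" for a b c
    using contract[OF bilinear_mul expand_e_skew[OF skew] expand_e_skew[OF skew]]
    by (simp add: bilinear_mapD[OF bilinear_mul] w)
  have "pairing3 \<omega> (\<Sum>p\<in>I. \<Sum>q\<in>I. pure3 (e p) (e q) (mul (f p) (f q))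
          + pure3 (e p) (star_product mul (f p) (e q)) (f q)
          + pure3 (mul (e p) (e q)) (f q) (f p)) a b c
      = \<omega> (mul a b) c - \<omega> (star_product mul a c) b + \<omega> (mul c b) a" for a b c
    using 1[of a b c] 2[of a c b] 3[of c b a] by (simp add: sum.distrib mult_ac)
  then show ?thesis
    unfolding novikov_YBE_def novikov_cocycle_def
    by (subst tensor3_eq_iff_pairing[OF form resolves_A resolves_A resolves_A,
          where U' = UNIV and V' = UNIV and W' = UNIV]) auto
qed

subsection \<open>Completed tensors over the affinization\<close>

lemmas bilinear_L_bracket = bilinear_map_aff_bracket[OF novikov]
lemmas form_L = bilinear_form_aff_form[OF form]
lemmas bilinear_L_form = form_L[unfolded bilinear_form_def]
lemmas L_form_monom = aff_form_monom[OF form]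
lemmas L_scale_monom = aff_scale_monom[OF vector_space_A]

lemma left_leg_contraction:
  assumes "l + k = - 1"
  shows "(\<Sum>\<alpha>\<in>I. L_scale (L_form (left_leg (l, \<alpha>)) (aff_monom a k)) (right_leg (l, \<alpha>)))
    = aff_monom a k"
proof -
  have "l = - 1 - k" using assms by simp
  then show ?thesis
    by (simp add: left_leg_def right_leg_def L_form_monom L_scale_monom aff_monom_simps(5)[symmetric]
        expand_f)
qed

lemma right_leg_contraction:
  assumes "skewsymmetric_form \<omega>"
  shows "(\<Sum>\<alpha>\<in>I. L_scale (L_form (right_leg (k, \<alpha>)) (aff_monom a k)) (left_leg (k, \<alpha>)))
    = - aff_monom a k"
  by (simp add: left_leg_def right_leg_def L_form_monom L_scale_monom
      aff_monom_simps(3,5)[symmetric] expand_e_skew[OF assms])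

lemma resolves_L:
  "resolves L_scale L_form I (aff_degree i)
     (\<lambda>\<alpha>. aff_monom (e \<alpha>) (i + 1)) (\<lambda>\<alpha>. aff_monom (f \<alpha>) (- i - 2))"
  unfolding resolves_def
  using subspace_aff_degree[OF vector_space_A]
  by (auto simp: aff_degree_def L_form_monom L_scale_monom aff_monom_simps(5)[symmetric] expand_e)

text \<open>
  Degree \<open>i\<close> of the affinization has exponent \<open>i + 1\<close> and is paired with exponent \<open>- i - 2\<close>.
\<close>

abbreviation "dual_monoms i \<equiv> range (\<lambda>a. aff_monom a (- i - 2))"

lemma detects_dual_monom:
  assumes "x \<in> dual_monoms i"
  shows "detects L_form aff_degree i x"
  using assms unfolding detects_def
  by (auto simp: aff_degree_def L_form_monom bilinear_mapD[OF bilinear_L_form])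

lemma homogeneous_legs: "homogeneous aff_degree (left_leg p)" "homogeneous aff_degree (right_leg p)"
  by (cases p; simp add: left_leg_def right_leg_def homogeneous_aff_monom)+

lemma leg_degree:
  "left_leg (l, \<alpha>) \<in> aff_degree i \<Longrightarrow> left_leg (l, \<alpha>) \<noteq> 0 \<Longrightarrow> l = i + 1"
  "right_leg (l, \<alpha>) \<in> aff_degree i \<Longrightarrow> right_leg (l, \<alpha>) \<noteq> 0 \<Longrightarrow> l = - i - 2"
  by (auto simp: left_leg_def right_leg_def aff_monom_in_aff_degree)

lemma sum_level: "(\<Sum>p\<in>{l} \<times> I. g p) = (\<Sum>\<alpha>\<in>I. g (l, \<alpha>))"
  using sum.cartesian_product[of "\<lambda>l \<alpha>. g (l, \<alpha>)" I "{l}"] by simp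

text \<open>
  The terms of a bidegree lie at the level where the left leg pairs with its test vector, so
  contraction exchanges the right leg for that vector. The components of \<open>r\<^sub>L\<close> and of its flip
  thus pair with \<open>x\<close>, \<open>y\<close> to \<open>(x, y)\<close> and \<open>(y, x)\<close>.
\<close>

lemma skewsymmetric_completed_iff:
  "skewsymmetric_completed L_scale aff_degree leg_indices left_leg right_leg
    \<longleftrightarrow> skewsymmetric_form \<omega>"
proof -
  have sub: "terms2 aff_degree leg_indices left_leg right_leg i j \<subseteq> {i + 1} \<times> I"
    "terms2 aff_degree leg_indices right_leg left_leg i j \<subseteq> {j + 1} \<times> I" for i j
    unfolding terms2_def by (auto dest: leg_degree)
  have fs: "formal_sum2 aff_degree leg_indices left_leg right_leg"
    unfolding formal_sum2_def
    by (intro conjI allI ballI homogeneous_legs finite_subset[OF sub(1)]) (simp add: finite_I)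
  have fin: "finite ({l} \<times> I)" and leg: "{l} \<times> I \<subseteq> leg_indices" for l :: int
    using finite_I by auto
  have lr: "pairing2 L_form (component2 aff_degree leg_indices left_leg right_leg i j) x y
      = L_form x y"
    if x: "x \<in> dual_monoms i" and y: "y \<in> dual_monoms j" for i j x y
  proof -
    have "pairing2 L_form (component2 aff_degree leg_indices left_leg right_leg i j) x y
        = (\<Sum>p\<in>{i + 1} \<times> I. L_form (left_leg p) x * L_form (right_leg p) y)"
      by (rule pairing2_component2[OF homogeneous_legs fin leg sub(1)
            detects_dual_monom[OF x] detects_dual_monom[OF y]])
    also have "\<dots> = L_form (\<Sum>\<alpha>\<in>I. L_scale (L_form (left_leg (i + 1, \<alpha>)) x) (right_leg (i + 1, \<alpha>))) y"
      unfolding sum_level by (rule form_contraction[OF form_L])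
    also have "\<dots> = L_form x y"
      using x by (auto simp: left_leg_contraction)
    finally show ?thesis .
  qed
  have rl: "pairing2 L_form (component2 aff_degree leg_indices right_leg left_leg i j) x y
      = L_form y x"
    if x: "x \<in> dual_monoms i" and y: "y \<in> dual_monoms j" for i j x y
  proof -
    have "pairing2 L_form (component2 aff_degree leg_indices right_leg left_leg i j) x y
        = (\<Sum>p\<in>{j + 1} \<times> I. L_form (right_leg p) x * L_form (left_leg p) y)"
      by (rule pairing2_component2[OF homogeneous_legs(2,1) fin leg sub(2)
            detects_dual_monom[OF x] detects_dual_monom[OF y]])
    also have "\<dots> = (\<Sum>\<alpha>\<in>I. L_form (left_leg (j + 1, \<alpha>)) y * L_form (right_leg (j + 1, \<alpha>)) x)"
      unfolding sum_level by (simp add: mult.commute)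
    also have "\<dots> = L_form (\<Sum>\<alpha>\<in>I. L_scale (L_form (left_leg (j + 1, \<alpha>)) y) (right_leg (j + 1, \<alpha>))) x"
      by (rule form_contraction[OF form_L])
    also have "\<dots> = L_form y x"
      using y by (auto simp: left_leg_contraction)
    finally show ?thesis .
  qed
  have "tensor2_eq L_scale (aff_degree i) (aff_degree j)
      (component2 aff_degree leg_indices right_leg left_leg i j)
      (- component2 aff_degree leg_indices left_leg right_leg i j)
    \<longleftrightarrow> (\<forall>x\<in>dual_monoms i. \<forall>y\<in>dual_monoms j. L_form y x = - L_form x y)" for i j
    by (subst tensor2_eq_iff_pairing[OF form_L resolves_L resolves_L,
          where U' = "dual_monoms i" and V' = "dual_monoms j"])
      (auto simp only: keys_component2 keys_uminus pairing2_simps lr rl cong: ball_cong)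
  moreover have "(\<forall>i j. \<forall>x\<in>dual_monoms i. \<forall>y\<in>dual_monoms j. L_form y x = - L_form x y)
      \<longleftrightarrow> skewsymmetric_form \<omega>" (is "?l = ?r")
  proof
    assume l: ?l
    have "\<omega> b a = - \<omega> a b" for a b
    proof -
      \<comment> \<open>The exponents \<open>0\<close> and \<open>- 1\<close> are paired with each other.\<close>
      have "aff_monom a 0 \<in> dual_monoms (- 2)" "aff_monom b (- 1) \<in> dual_monoms (- 1)" by auto
      then have "L_form (aff_monom b (- 1)) (aff_monom a 0)
          = - L_form (aff_monom a 0) (aff_monom b (- 1))"
        using l by blast
      then show ?thesis by (simp add: L_form_monom)
    qed
    then show ?r unfolding skewsymmetric_form_def by blast
  next
    assume r: ?r
    have "L_form (aff_monom b j) (aff_monom a i)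
        = - L_form (aff_monom a i) (aff_monom b j)" for a b i j
      using r[unfolded skewsymmetric_form_def, rule_format, of b a]
      by (simp only: L_form_monom add.commute[of j] mult_minus_left)
    then show ?l by blast
  qed
  ultimately show ?thesis
    using fs by (simp add: skewsymmetric_completed_def)
qed

subsection \<open>The cocycle identities\<close>

definition L_cyclic_sum :: "(int \<Rightarrow>\<^sub>0 'a) \<Rightarrow> (int \<Rightarrow>\<^sub>0 'a) \<Rightarrow> (int \<Rightarrow>\<^sub>0 'a) \<Rightarrow> 'k" where
  "L_cyclic_sum x y z =
     L_form (L_bracket x y) z + L_form (L_bracket z x) y + L_form (L_bracket y z) x"

lemma L_bracket_monom:
  "L_bracket (aff_monom a i) (aff_monom b j)
    = aff_monom (scale (of_int i) (mul a b) - scale (of_int j) (mul b a)) (i + j - 1)"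
  by (simp add: aff_bracket_monom[OF novikov] aff_monom_simps)

text \<open>
  The form forces \<open>i + j + k = 0\<close>. Substituting \<open>k = - i - j\<close> and collecting the coefficients of
  \<open>i\<close> and \<open>j\<close> gives the cocycle expression of \<open>\<omega>\<close> twice.
\<close>

lemma L_cyclic_sum_monom:
  "L_cyclic_sum (aff_monom a i) (aff_monom b j) (aff_monom c k) =
    (if i + j + k = 0 then
       of_int i * (\<omega> (mul a b) c - \<omega> (star_product mul a c) b + \<omega> (mul c b) a)
       - of_int j * (\<omega> (mul b a) c - \<omega> (star_product mul b c) a + \<omega> (mul c a) b)
     else 0)"
proof -
  note cyc = L_cyclic_sum_def L_bracket_monom L_form_monom bilinear_mapD[OF bilinear_\<omega>]
  show ?thesis
  proof (cases "i + j + k = 0")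
    case True
    then have k: "k = - i - j" by simp
    show ?thesis
      unfolding k by (simp add: cyc star_product_def algebra_simps)
  next
    case False
    then show ?thesis by (simp add: cyc algebra_simps)
  qed
qed

lemma L_cyclic_sum_monom_zero_iff:
  "(\<forall>a b c i j k. L_cyclic_sum (aff_monom a i) (aff_monom b j) (aff_monom c k) = 0)
    \<longleftrightarrow> novikov_cocycle"
proof
  assume l: "\<forall>a b c i j k. L_cyclic_sum (aff_monom a i) (aff_monom b j) (aff_monom c k) = 0"
  \<comment> \<open>The exponents \<open>1, 0, - 1\<close> isolate the expression multiplied by \<open>i\<close>.\<close>
  have "\<omega> (mul a b) c - \<omega> (star_product mul a c) b + \<omega> (mul c b) a = 0" for a b c
    using l[rule_format, of a 1 b 0 c "- 1"] by (simp add: L_cyclic_sum_monom)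
  then show novikov_cocycle by (simp add: novikov_cocycle_def)
next
  assume r: novikov_cocycle
  then show "\<forall>a b c i j k. L_cyclic_sum (aff_monom a i) (aff_monom b j) (aff_monom c k) = 0"
    unfolding L_cyclic_sum_monom using r[unfolded novikov_cocycle_def] by simp
qed

lemma L_cyclic_sum_zero_iff: "(\<forall>x y z. L_cyclic_sum x y z = 0) \<longleftrightarrow> novikov_cocycle"
proof
  assume "\<forall>x y z. L_cyclic_sum x y z = 0"
  then show novikov_cocycle
    unfolding L_cyclic_sum_monom_zero_iff[symmetric] by simp
next
  assume n: novikov_cocycle
  have "L_cyclic_sum x y z = 0" for x y z
  proof (rule triadditive_aff_zero[where T = L_cyclic_sum])
    show "L_cyclic_sum (aff_monom a i) (aff_monom b j) (aff_monom c k) = 0" for a b c i j k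
      using n[folded L_cyclic_sum_monom_zero_iff] by simp
  qed (simp_all add: additive_def L_cyclic_sum_def bilinear_mapD(1,2)[OF bilinear_L_bracket]
        bilinear_mapD(1,2)[OF bilinear_L_form])
  then show "\<forall>x y z. L_cyclic_sum x y z = 0" by simp
qed

lemma L_bracket_antisym: "L_bracket x y = - L_bracket y x"
proof -
  have sq: "L_bracket v v = 0" for v
    using lie_algebra_affinization[OF novikov] by (simp add: lie_algebra_def)
  have "L_bracket x y + L_bracket y x = 0"
    using sq[of "x + y"] sq[of x] sq[of y]
    by (simp add: bilinear_mapD(1,2)[OF bilinear_L_bracket] add.commute)
  then show ?thesis by (simp add: eq_neg_iff_add_eq_0)
qed

subsection \<open>The classical Yang-Baxter equation\<close>

lemma homogeneous_bracket_legs: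
  "homogeneous aff_degree (L_bracket (left_leg p) (left_leg q))"
  "homogeneous aff_degree (L_bracket (right_leg p) (left_leg q))"
  "homogeneous aff_degree (L_bracket (right_leg p) (right_leg q))"
  by (cases p; cases q; simp add: left_leg_def right_leg_def L_bracket_monom homogeneous_aff_monom)+

lemma sum_level2:
  "(\<Sum>pq\<in>({l} \<times> I) \<times> ({n} \<times> I). g pq) = (\<Sum>\<alpha>\<in>I. \<Sum>\<beta>\<in>I. g ((l, \<alpha>), (n, \<beta>)))"
  using sum.cartesian_product[of "\<lambda>p q. g (p, q)" "{n} \<times> I" "{l} \<times> I"] by (simp add: sum_level)

abbreviation "leg_pairs \<equiv> leg_indices \<times> leg_indices"

abbreviation "cybe1 \<equiv> component3 aff_degree leg_pairs
  (\<lambda>(p, q). L_bracket (left_leg p) (left_leg q)) (\<lambda>(p, q). right_leg p) (\<lambda>(p, q). right_leg q)"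
abbreviation "cybe2 \<equiv> component3 aff_degree leg_pairs
  (\<lambda>(p, q). left_leg p) (\<lambda>(p, q). L_bracket (right_leg p) (left_leg q)) (\<lambda>(p, q). right_leg q)"
abbreviation "cybe3 \<equiv> component3 aff_degree leg_pairs
  (\<lambda>(p, q). left_leg p) (\<lambda>(p, q). left_leg q) (\<lambda>(p, q). L_bracket (right_leg p) (right_leg q))"

text \<open>
  The two factors that are plain legs fix the exponents of both indices, so each multidegree
  receives only finitely many terms.
\<close>

lemma cybe_terms:
  "terms3 aff_degree leg_pairs (\<lambda>(p, q). L_bracket (left_leg p) (left_leg q))
     (\<lambda>(p, q). right_leg p) (\<lambda>(p, q). right_leg q) i j k
   \<subseteq> ({- j - 2} \<times> I) \<times> ({- k - 2} \<times> I)"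
  "terms3 aff_degree leg_pairs (\<lambda>(p, q). left_leg p)
     (\<lambda>(p, q). L_bracket (right_leg p) (left_leg q)) (\<lambda>(p, q). right_leg q) i j k
   \<subseteq> ({i + 1} \<times> I) \<times> ({- k - 2} \<times> I)"
  "terms3 aff_degree leg_pairs (\<lambda>(p, q). left_leg p) (\<lambda>(p, q). left_leg q)
     (\<lambda>(p, q). L_bracket (right_leg p) (right_leg q)) i j k
   \<subseteq> ({i + 1} \<times> I) \<times> ({j + 1} \<times> I)"
  unfolding terms3_def by (auto dest: leg_degree)

lemma finite_leg_pairs: "finite (({l :: int} \<times> I) \<times> ({n :: int} \<times> I))"
  using finite_I by simp

text \<open>
  The legs paired with \<open>x\<close>, \<open>y\<close>, \<open>z\<close> are exchanged for these vectors. In the first term the two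
  minus signs cancel; in the second, the single one is absorbed by reversing the bracket.
\<close>

lemma pairing3_cybe:
  assumes skew: "skewsymmetric_form \<omega>"
    and x: "x \<in> dual_monoms i" and y: "y \<in> dual_monoms j" and z: "z \<in> dual_monoms k"
  shows "pairing3 L_form (cybe1 i j k) x y z = L_form (L_bracket y z) x"
    and "pairing3 L_form (cybe2 i j k) x y z = L_form (L_bracket z x) y"
    and "pairing3 L_form (cybe3 i j k) x y z = L_form (L_bracket x y) z"
proof -
  note br = bilinear_mapD[OF bilinear_L_bracket]
  note B = bilinear_mapD[OF bilinear_L_form]
  note det = detects_dual_monom[OF x] detects_dual_monom[OF y] detects_dual_monom[OF z]
  note contract = product_contraction[OF form_L bilinear_L_bracket, where T = I]
  have sub: "({l} \<times> I) \<times> ({n} \<times> I) \<subseteq> leg_pairs" for l n :: int by auto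
  have x_res: "(\<Sum>\<alpha>\<in>I. L_scale (L_form (left_leg (i + 1, \<alpha>)) x) (right_leg (i + 1, \<alpha>))) = x"
    using x by (auto simp: left_leg_contraction)
  have y_res: "(\<Sum>\<alpha>\<in>I. L_scale (L_form (left_leg (j + 1, \<alpha>)) y) (right_leg (j + 1, \<alpha>))) = y"
    "(\<Sum>\<alpha>\<in>I. L_scale (L_form (right_leg (- j - 2, \<alpha>)) y) (left_leg (- j - 2, \<alpha>))) = - y"
    using y by (auto simp: left_leg_contraction right_leg_contraction[OF skew])
  have z_res: "(\<Sum>\<alpha>\<in>I. L_scale (L_form (right_leg (- k - 2, \<alpha>)) z) (left_leg (- k - 2, \<alpha>))) = - z"
    using z by (auto simp: right_leg_contraction[OF skew])
  have "pairing3 L_form (cybe1 i j k) x y z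
      = (\<Sum>\<alpha>\<in>I. \<Sum>\<beta>\<in>I. L_form (right_leg (- j - 2, \<alpha>)) y * L_form (right_leg (- k - 2, \<beta>)) z
          * L_form (L_bracket (left_leg (- j - 2, \<alpha>)) (left_leg (- k - 2, \<beta>))) x)"
    by (subst pairing3_component3[OF _ finite_leg_pairs sub cybe_terms(1) det])
      (auto simp: homogeneous_legs homogeneous_bracket_legs sum_level2 mult_ac)
  also have "\<dots> = L_form (L_bracket (- y) (- z)) x"
    by (rule contract[OF y_res(2) z_res])
  finally show "pairing3 L_form (cybe1 i j k) x y z = L_form (L_bracket y z) x"
    by (simp add: br(5,6))
  have "pairing3 L_form (cybe2 i j k) x y z
      = (\<Sum>\<alpha>\<in>I. \<Sum>\<beta>\<in>I. L_form (left_leg (i + 1, \<alpha>)) x * L_form (right_leg (- k - 2, \<beta>)) z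
          * L_form (L_bracket (right_leg (i + 1, \<alpha>)) (left_leg (- k - 2, \<beta>))) y)"
    by (subst pairing3_component3[OF _ finite_leg_pairs sub cybe_terms(2) det])
      (auto simp: homogeneous_legs homogeneous_bracket_legs sum_level2 mult_ac)
  also have "\<dots> = L_form (L_bracket x (- z)) y"
    by (rule contract[OF x_res z_res])
  also have "L_bracket x (- z) = L_bracket z x"
    using L_bracket_antisym[of z x] by (simp add: br(6))
  finally show "pairing3 L_form (cybe2 i j k) x y z = L_form (L_bracket z x) y" .
  have "pairing3 L_form (cybe3 i j k) x y z
      = (\<Sum>\<alpha>\<in>I. \<Sum>\<beta>\<in>I. L_form (left_leg (i + 1, \<alpha>)) x * L_form (left_leg (j + 1, \<beta>)) y
          * L_form (L_bracket (right_leg (i + 1, \<alpha>)) (right_leg (j + 1, \<beta>))) z)"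
    by (subst pairing3_component3[OF _ finite_leg_pairs sub cybe_terms(3) det])
      (auto simp: homogeneous_legs homogeneous_bracket_legs sum_level2 mult_ac)
  also have "\<dots> = L_form (L_bracket x y) z"
    by (rule contract[OF x_res y_res(1)])
  finally show "pairing3 L_form (cybe3 i j k) x y z = L_form (L_bracket x y) z" .
qed

lemma completed_CYBE_iff:
  assumes skew: "skewsymmetric_form \<omega>"
  shows "completed_CYBE L_scale L_bracket aff_degree leg_indices left_leg right_leg
    \<longleftrightarrow> novikov_cocycle"
proof -
  have keys: "Poly_Mapping.keys (cybe1 i j k + cybe2 i j k + cybe3 i j k)
      \<subseteq> aff_degree i \<times> aff_degree j \<times> aff_degree k" for i j k
    by (intro order_trans[OF keys_add] Un_least keys_component3)
  have pair: "pairing3 L_form (cybe1 i j k + cybe2 i j k + cybe3 i j k) x y z = L_cyclic_sum x y z"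
    if "x \<in> dual_monoms i" "y \<in> dual_monoms j" "z \<in> dual_monoms k" for i j k x y z
    by (simp add: pairing3_cybe[OF skew that] L_cyclic_sum_def)
  have "tensor3_eq L_scale (aff_degree i) (aff_degree j) (aff_degree k)
      (cybe1 i j k + cybe2 i j k + cybe3 i j k) 0
    \<longleftrightarrow> (\<forall>x\<in>dual_monoms i. \<forall>y\<in>dual_monoms j. \<forall>z\<in>dual_monoms k. L_cyclic_sum x y z = 0)" for i j k
    by (subst tensor3_eq_iff_pairing[OF form_L resolves_L resolves_L resolves_L _ _ _ keys,
          where U' = "dual_monoms i" and V' = "dual_monoms j" and W' = "dual_monoms k"])
      (auto simp only: pair cong: ball_cong)
  moreover have "(\<forall>i j k. \<forall>x\<in>dual_monoms i. \<forall>y\<in>dual_monoms j. \<forall>z\<in>dual_monoms k.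
      L_cyclic_sum x y z = 0) \<longleftrightarrow> novikov_cocycle" (is "?l \<longleftrightarrow> _")
  proof
    assume l: ?l
    have dm: "aff_monom a i \<in> dual_monoms (- i - 2)" for a i by simp
    have "L_cyclic_sum (aff_monom a i) (aff_monom b j) (aff_monom c k) = 0" for a b c i j k
      by (rule l[rule_format, OF dm dm dm])
    then show novikov_cocycle unfolding L_cyclic_sum_monom_zero_iff[symmetric] by simp
  next
    assume novikov_cocycle
    then show ?l unfolding L_cyclic_sum_zero_iff[symmetric] by simp
  qed
  moreover have
    "formal_sum3 aff_degree leg_pairs (\<lambda>(p, q). L_bracket (left_leg p) (left_leg q))
       (\<lambda>(p, q). right_leg p) (\<lambda>(p, q). right_leg q)"
    "formal_sum3 aff_degree leg_pairs (\<lambda>(p, q). left_leg p)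
       (\<lambda>(p, q). L_bracket (right_leg p) (left_leg q)) (\<lambda>(p, q). right_leg q)"
    "formal_sum3 aff_degree leg_pairs (\<lambda>(p, q). left_leg p) (\<lambda>(p, q). left_leg q)
       (\<lambda>(p, q). L_bracket (right_leg p) (right_leg q))"
    unfolding formal_sum3_def
    using finite_subset[OF cybe_terms(1) finite_leg_pairs]
      finite_subset[OF cybe_terms(2) finite_leg_pairs]
      finite_subset[OF cybe_terms(3) finite_leg_pairs]
    by (simp_all add: case_prod_beta homogeneous_legs homogeneous_bracket_legs)
  ultimately show ?thesis
    by (simp add: completed_CYBE_def)
qed

subsection \<open>The quasi-Frobenius Lie algebra\<close>

lemma graded_lie_algebra_affinization: "graded_lie_algebra L_scale L_bracket aff_degree"
proof -
  interpret L: vector_space L_scale by (rule vector_space_aff_scale[OF vector_space_A])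
  have "\<exists>B. finite B \<and> L.span B = aff_degree i" for i
  proof (intro exI conjI)
    let ?e = "\<lambda>\<alpha>. aff_monom (e \<alpha>) (i + 1)"
    show "finite (?e ` I)" using finite_I by simp
    show "L.span (?e ` I) = aff_degree i"
    proof
      show "L.span (?e ` I) \<subseteq> aff_degree i"
        using resolves_L[of i] by (intro L.span_minimal) (auto simp: resolves_def)
      show "aff_degree i \<subseteq> L.span (?e ` I)"
      proof
        fix x :: "int \<Rightarrow>\<^sub>0 'a" assume "x \<in> aff_degree i"
        then have x: "x = (\<Sum>\<alpha>\<in>I. L_scale (L_form x (aff_monom (f \<alpha>) (- i - 2))) (?e \<alpha>))"
          using resolves_L[of i] unfolding resolves_def by blast
        show "x \<in> L.span (?e ` I)"
          by (subst x) (intro L.span_sum L.span_scale L.span_base imageI)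
      qed
    qed
  qed
  moreover have "L_bracket x y \<in> aff_degree (i + j)"
    if "x \<in> aff_degree i" "y \<in> aff_degree j" for x y i j
  proof -
    from that obtain a b where "x = aff_monom a (i + 1)" "y = aff_monom b (j + 1)"
      by (auto simp: aff_degree_def)
    then show ?thesis by (simp add: L_bracket_monom aff_monom_in_aff_degree)
  qed
  ultimately show ?thesis
    using lie_algebra_affinization[OF novikov] Z_grading_affinization[OF vector_space_A]
    by (auto simp: graded_lie_algebra_def)
qed

text \<open>
  Pairing with monomials reads off the pairings of the single coefficients.
\<close>

lemma nondegenerate_L_form: "nondegenerate_form L_form"
proof -
  have right: "L_form x (aff_monom b (- k - 1)) = \<omega> (Poly_Mapping.lookup x k) b" for x b k
  proof (induction x rule: aff_induct)
    case (monom a i)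
    then show ?case
      by (auto simp: L_form_monom bilinear_mapD[OF bilinear_\<omega>])
        (auto simp: aff_monom_def lookup_single when_def bilinear_mapD[OF bilinear_\<omega>])
  qed (simp_all add: bilinear_mapD[OF bilinear_L_form] bilinear_mapD[OF bilinear_\<omega>] lookup_add)
  have left: "L_form (aff_monom b (- k - 1)) x = \<omega> b (Poly_Mapping.lookup x k)" for x b k
  proof (induction x rule: aff_induct)
    case (monom a i)
    then show ?case
      by (auto simp: L_form_monom bilinear_mapD[OF bilinear_\<omega>])
        (auto simp: aff_monom_def lookup_single when_def bilinear_mapD[OF bilinear_\<omega>])
  qed (simp_all add: bilinear_mapD[OF bilinear_L_form] bilinear_mapD[OF bilinear_\<omega>] lookup_add)
  have "x = 0" if "\<forall>y. L_form x y = 0" for x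
  proof (rule poly_mapping_eqI)
    fix k
    have "\<omega> (Poly_Mapping.lookup x k) b = 0" for b using that right by metis
    then show "Poly_Mapping.lookup x k = Poly_Mapping.lookup 0 k"
      using nondeg unfolding nondegenerate_form_def by simp
  qed
  moreover have "x = 0" if "\<forall>y. L_form y x = 0" for x
  proof (rule poly_mapping_eqI)
    fix k
    have "\<omega> b (Poly_Mapping.lookup x k) = 0" for b using that left by metis
    then show "Poly_Mapping.lookup x k = Poly_Mapping.lookup 0 k"
      using nondeg unfolding nondegenerate_form_def by simp
  qed
  ultimately show ?thesis by (simp add: nondegenerate_form_def)
qed

lemma skewsymmetric_L_form_iff: "skewsymmetric_form L_form \<longleftrightarrow> skewsymmetric_form \<omega>"
proof
  assume l: "skewsymmetric_form L_form"
  have "\<omega> a b = - \<omega> b a" for a b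
    using l[unfolded skewsymmetric_form_def, rule_format, of "aff_monom a 0" "aff_monom b (- 1)"]
    by (simp add: L_form_monom)
  then show "skewsymmetric_form \<omega>" unfolding skewsymmetric_form_def by blast
next
  assume r: "skewsymmetric_form \<omega>"
  have "L_form x y + L_form y x = 0" for x y
  proof (rule biadditive_aff_zero[where T = "\<lambda>x y. L_form x y + L_form y x"])
    fix a b :: 'a and i j :: int
    show "L_form (aff_monom a i) (aff_monom b j) + L_form (aff_monom b j) (aff_monom a i) = 0"
      using r[unfolded skewsymmetric_form_def, rule_format, of a b]
      by (simp add: L_form_monom add.commute)
  qed (simp_all add: additive_def bilinear_mapD[OF bilinear_L_form])
  then show "skewsymmetric_form L_form"
    unfolding skewsymmetric_form_def by (simp add: eq_neg_iff_add_eq_0)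
qed

lemma quasi_Frobenius_graded_lie_algebra_iff:
  "quasi_Frobenius_graded_lie_algebra L_scale L_bracket aff_degree L_form
    \<longleftrightarrow> skewsymmetric_form \<omega> \<and> novikov_cocycle"
proof -
  \<comment> \<open>Degrees \<open>i, j\<close> have exponents \<open>i + 1, j + 1\<close>, so \<open>i + j + 3 = 0\<close> is the condition of the form.\<close>
  have "\<forall>i j. i + j + 3 \<noteq> 0 \<longrightarrow> (\<forall>x\<in>aff_degree i. \<forall>y\<in>aff_degree j. L_form x y = 0)"
    by (auto simp: aff_degree_def L_form_monom)
  then have "\<exists>m. \<forall>i j. i + j + m \<noteq> 0 \<longrightarrow> (\<forall>x\<in>aff_degree i. \<forall>y\<in>aff_degree j. L_form x y = 0)"
    by blast
  then show ?thesis
    unfolding quasi_Frobenius_graded_lie_algebra_def L_cyclic_sum_def[symmetric]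
      L_cyclic_sum_zero_iff
    using graded_lie_algebra_affinization form_L nondegenerate_L_form
    by (simp add: skewsymmetric_L_form_iff)
qed

end

theorem theorem4p10:
  fixes scale :: "'k::field_char_0 \<Rightarrow> 'a::ab_group_add \<Rightarrow> 'a"
    and mul :: "'a \<Rightarrow> 'a \<Rightarrow> 'a"
    and \<omega> :: "'a \<Rightarrow> 'a \<Rightarrow> 'k"
    and I :: "'i set"
    and e f :: "'i \<Rightarrow> 'a"
  assumes "novikov_algebra scale mul"
    and "bilinear_form scale \<omega>" and "nondegenerate_form \<omega>"
    and "inj_on e I" and "finite_dimensional_vector_space scale (e ` I)"
    and "\<forall>\<alpha>\<in>I. \<forall>\<beta>\<in>I. \<omega> (e \<alpha>) (f \<beta>) = (if \<alpha> = \<beta> then 1 else 0)"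
  shows
    "(quasi_Frobenius_novikov scale mul \<omega>
       \<longleftrightarrow> skewsymmetric_tensor scale I e f \<and> novikov_YBE scale mul I e f) \<and>
     (skewsymmetric_tensor scale I e f \<and> novikov_YBE scale mul I e f
       \<longleftrightarrow> skewsymmetric_completed_CYBE_solution (aff_scale scale) (aff_bracket scale mul) aff_degree
             ((UNIV :: int set) \<times> I)
             (\<lambda>(i, \<alpha>). aff_monom (e \<alpha>) i) (\<lambda>(i, \<alpha>). aff_monom (f \<alpha>) (- i - 1))) \<and>
     (skewsymmetric_completed_CYBE_solution (aff_scale scale) (aff_bracket scale mul) aff_degree
             ((UNIV :: int set) \<times> I)
             (\<lambda>(i, \<alpha>). aff_monom (e \<alpha>) i) (\<lambda>(i, \<alpha>). aff_monom (f \<alpha>) (- i - 1))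
       \<longleftrightarrow> quasi_Frobenius_graded_lie_algebra (aff_scale scale) (aff_bracket scale mul) aff_degree
             (aff_form \<omega>))"
proof -
  interpret novikov_dual_bases scale mul \<omega> I e f
    using assms by (rule novikov_dual_bases.intro)
  have "skewsymmetric_tensor scale I e f \<and> novikov_YBE scale mul I e f
      \<longleftrightarrow> skewsymmetric_form \<omega> \<and> novikov_cocycle"
    using skewsymmetric_tensor_iff novikov_YBE_iff by blast
  moreover have "skewsymmetric_completed_CYBE_solution L_scale L_bracket aff_degree leg_indices
      left_leg right_leg \<longleftrightarrow> skewsymmetric_form \<omega> \<and> novikov_cocycle"
    unfolding skewsymmetric_completed_CYBE_solution_def
    using skewsymmetric_completed_iff completed_CYBE_iff by blast
  ultimately show ?thesis
    unfolding left_leg_def right_leg_def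
    using quasi_Frobenius_novikov_iff quasi_Frobenius_graded_lie_algebra_iff by blast
qed

end
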